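(* Let $\lambda>0$, $\psi\ge 0$ and $\omega\in\mathbb{R}$ be given constants. Let $P:\mathcal{H}^1(0,1)\times\mathcal{H}^1(0,1)\to\mathcal{H}^1(0,1)$ be the linear operator $$(P(u,v))(x)=v(x)-\mathrm{e}^{-\lambda^{-1}\psi x}v(0)+\lambda^{-1}\omega\int_0^x \mathrm{e}^{-\lambda^{-1}\psi(x-s)}u(s)\,ds,\qquad x\in[0,1],$$ and let $S\subset\mathcal{H}^1(0,1)\times\mathcal{H}^1(0,1)$ be the linear subspace $S=\{(u,v)\in\mathcal{H}^1(0,1)\times\mathcal{H}^1(0,1): P(u,v)=0\}$. Then for all $(u_0,v_0)\in(\mathcal{H}^1(0,1)\times\mathcal{H}^1(0,1))\setminus S$ the following property holds: for every input $U\in\mathcal{C}^1(\mathbb{R}_+)$ with $U(0)=u_0(0)$, the corresponding unique solution $(u,v)\in\left(\mathcal{C}^0(\mathbb{R}_+;\mathcal{H}^1(0,1))\cap\mathcal{C}^1(\mathbb{R}_+;\mathcal{L}^2(0,1))\right)^2$ of the initial-boundary value problem $$\partial_t u(t,x)=-\lambda\,\partial_x u(t,x),\qquad \partial_t v(t,x)=\psi v(t,x)+\omega u(t,x),\qquad u(t,0)=U(t),$$ $$u(0,x)=u_0(x),\qquad v(0,x)=v_0(x),\qquad t\ge 0,\ x\in[0,1],$$ does not satisfy $\lim_{t\to\infty}\|u[t]\|_2=\lim_{t\to\infty}\|v[t]\|_2=0$.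
   Context: $\mathbb{R}_+=[0,\infty)$. For $u:\mathbb{R}_+\times[0,1]\to\mathbb{R}$, $u[t]$ denotes the profile at time $t\ge0$, i.e. $(u[t])(x)=u(t,x)$ for $x\in[0,1]$. $\|f\|_2=\left(\int_0^1|f(x)|^2dx\right)^{1/2}$ is the norm of $\mathcal{L}^2(0,1)$. $\mathcal{H}^1(0,1)$ is the Sobolev space of functions in $\mathcal{L}^2(0,1)$ with first-order weak derivative in $\mathcal{L}^2(0,1)$; its elements are identified with their continuous representatives on $[0,1]$. *)

theory Defs
  imports "HOL-Analysis.Analysis"
begin

text \<open>
  Elements of \<open>L\<^sup>2(0,1)\<close> and \<open>H\<^sup>1(0,1)\<close> are represented by functions \<open>real \<Rightarrow> real\<close> of which only the
  values on \<open>[0,1]\<close> matter. Equality in \<open>L\<^sup>2(0,1)\<close> is equality almost everywhere; members of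
  \<open>H\<^sup>1(0,1)\<close> are continuous on \<open>[0,1]\<close>, so equality in \<open>H\<^sup>1(0,1)\<close> is pointwise equality on \<open>[0,1]\<close>.
\<close>

definition L2 :: "(real \<Rightarrow> real) set" where
  "L2 = {f. f \<in> borel_measurable (lebesgue_on {0..1}) \<and>
            integrable (lebesgue_on {0..1}) (\<lambda>x. \<bar>f x\<bar>\<^sup>2)}"

text \<open>Only meaningful on \<open>L2\<close>: the Bochner integral of a non-integrable function is \<open>0\<close>.\<close>

definition norm2 :: "(real \<Rightarrow> real) \<Rightarrow> real" where
  "norm2 f = sqrt (\<integral>x. \<bar>f x\<bar>\<^sup>2 \<partial>lebesgue_on {0..1})"

text \<open>\<open>C\<^sub>c\<^sup>\<infinity>(0,1)\<close>, extended by zero to the real line.\<close>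

definition test_function :: "(real \<Rightarrow> real) \<Rightarrow> bool" where
  "test_function \<phi> \<longleftrightarrow>
     (\<forall>n x. (deriv ^^ n) \<phi> field_differentiable (at x)) \<and>
     compact (closure {x. \<phi> x \<noteq> 0}) \<and> closure {x. \<phi> x \<noteq> 0} \<subseteq> {0<..<1}"

text \<open>\<open>g \<in> L\<^sup>2(0,1)\<close> is a weak derivative of \<open>f \<in> L\<^sup>2(0,1)\<close>.\<close>

definition has_weak_derivative :: "(real \<Rightarrow> real) \<Rightarrow> (real \<Rightarrow> real) \<Rightarrow> bool" where
  "has_weak_derivative f g \<longleftrightarrow> f \<in> L2 \<and> g \<in> L2 \<and>
     (\<forall>\<phi>. test_function \<phi> \<longrightarrow>
        (\<integral>x. f x * deriv \<phi> x \<partial>lebesgue_on {0..1}) = - (\<integral>x. g x * \<phi> x \<partial>lebesgue_on {0..1}))"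

definition H1 :: "(real \<Rightarrow> real) set" where
  "H1 = {f. f \<in> L2 \<and> (\<exists>g. has_weak_derivative f g) \<and> continuous_on {0..1} f}"

text \<open>The weak derivative is unique up to null sets; \<open>weak_deriv f\<close> is some representative.\<close>

definition weak_deriv :: "(real \<Rightarrow> real) \<Rightarrow> real \<Rightarrow> real" where
  "weak_deriv f = (SOME g. has_weak_derivative f g)"

definition H1_norm :: "(real \<Rightarrow> real) \<Rightarrow> real" where
  "H1_norm f = sqrt ((norm2 f)\<^sup>2 + (norm2 (weak_deriv f))\<^sup>2)"

text \<open>
  A function \<open>u\<close> of \<open>(t,x)\<close> is curried, so that the profile \<open>u[t]\<close> is \<open>u t\<close>. Only times \<open>t \<ge> 0\<close>
  matter; continuity and derivatives in time are one-sided at \<open>t = 0\<close>.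
\<close>

definition C0_L2 :: "(real \<Rightarrow> real \<Rightarrow> real) \<Rightarrow> bool" where
  "C0_L2 u \<longleftrightarrow> (\<forall>t\<ge>0. u t \<in> L2) \<and>
     (\<forall>t\<ge>0. ((\<lambda>s. norm2 (\<lambda>x. u s x - u t x)) \<longlongrightarrow> 0) (at t within {0..}))"

definition C0_H1 :: "(real \<Rightarrow> real \<Rightarrow> real) \<Rightarrow> bool" where
  "C0_H1 u \<longleftrightarrow> (\<forall>t\<ge>0. u t \<in> H1) \<and>
     (\<forall>t\<ge>0. ((\<lambda>s. H1_norm (\<lambda>x. u s x - u t x)) \<longlongrightarrow> 0) (at t within {0..}))"

text \<open>\<open>d\<close> is the derivative at time \<open>t\<close> of the \<open>L\<^sup>2(0,1)\<close>-valued map \<open>s \<mapsto> u[s]\<close>, that is, \<open>\<partial>\<^sub>t u[t] = d\<close>.\<close>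

definition has_L2_time_derivative ::
    "(real \<Rightarrow> real \<Rightarrow> real) \<Rightarrow> (real \<Rightarrow> real) \<Rightarrow> real \<Rightarrow> bool" where
  "has_L2_time_derivative u d t \<longleftrightarrow> (\<forall>s\<ge>0. u s \<in> L2) \<and> d \<in> L2 \<and>
     ((\<lambda>s. norm2 (\<lambda>x. (u s x - u t x) / (s - t) - d x)) \<longlongrightarrow> 0) (at t within {0..})"

definition C1_L2 :: "(real \<Rightarrow> real \<Rightarrow> real) \<Rightarrow> bool" where
  "C1_L2 u \<longleftrightarrow> (\<exists>w. C0_L2 w \<and> (\<forall>t\<ge>0. has_L2_time_derivative u (w t) t))"

definition C1_input :: "(real \<Rightarrow> real) \<Rightarrow> bool" where
  "C1_input U \<longleftrightarrow> (\<exists>U'. continuous_on {0..} U' \<and>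
     (\<forall>t\<ge>0. (U has_real_derivative U' t) (at t within {0..})))"

definition P_op :: "real \<Rightarrow> real \<Rightarrow> real \<Rightarrow> (real \<Rightarrow> real) \<times> (real \<Rightarrow> real) \<Rightarrow> real \<Rightarrow> real" where
  "P_op lam \<psi> \<omega> = (\<lambda>(u, v) x.
     v x - exp (- (inverse lam * \<psi> * x)) * v 0
       + inverse lam * \<omega> * integral {0..x} (\<lambda>s. exp (- (inverse lam * \<psi> * (x - s))) * u s))"

definition S_space :: "real \<Rightarrow> real \<Rightarrow> real \<Rightarrow> ((real \<Rightarrow> real) \<times> (real \<Rightarrow> real)) set" where
  "S_space lam \<psi> \<omega> = {w \<in> H1 \<times> H1. \<forall>x\<in>{0..1}. P_op lam \<psi> \<omega> w x = 0}"

text \<open>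
  For each \<open>t\<close> the two differential equations are identities in \<open>L\<^sup>2(0,1)\<close>, with the strong
  \<open>L\<^sup>2\<close>-derivative in time and the weak derivative in space. Initial and boundary conditions
  are pointwise, through the continuous representatives.
\<close>

definition is_solution ::
    "real \<Rightarrow> real \<Rightarrow> real \<Rightarrow> (real \<Rightarrow> real) \<Rightarrow> (real \<Rightarrow> real) \<Rightarrow> (real \<Rightarrow> real) \<Rightarrow>
     (real \<Rightarrow> real \<Rightarrow> real) \<Rightarrow> (real \<Rightarrow> real \<Rightarrow> real) \<Rightarrow> bool" where
  "is_solution lam \<psi> \<omega> u0 v0 U u v \<longleftrightarrow>
     C0_H1 u \<and> C1_L2 u \<and> C0_H1 v \<and> C1_L2 v \<and>
     (\<forall>t\<ge>0. has_L2_time_derivative u (\<lambda>x. - lam * weak_deriv (u t) x) t) \<and>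
     (\<forall>t\<ge>0. has_L2_time_derivative v (\<lambda>x. \<psi> * v t x + \<omega> * u t x) t) \<and>
     (\<forall>t\<ge>0. u t 0 = U t) \<and>
     (\<forall>x\<in>{0..1}. u 0 x = u0 x \<and> v 0 x = v0 x)"

end

theory Submission
  imports Defs "HOL-Computational_Algebra.Polynomial"
begin

text \<open>
  Transport at speed \<open>lam\<close> keeps the profile of \<open>u\<close>. Gluing the initial profile \<open>u0\<close> and the input
  into one function \<open>w\<close> on the line gives \<open>u(t,x) = w(x - lam t)\<close>, and the second equation is a linear ordinary
  differential equation in \<open>t\<close> at each \<open>x\<close>. With an antiderivative \<open>G\<close> of \<open>exp(\<psi> y / lam) w(y)\<close> it integrates to
  \<open>v(t,x) = exp(\<psi> t) v0(x) + (\<omega> / lam) exp(\<psi> t - \<psi> x / lam) (G(x) - G(x - lam t))\<close>.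

  Why this cannot be steered to zero: the function \<open>h(x) = exp(\<psi> x / lam) v0(x) + (\<omega> / lam) G(x)\<close> satisfies
  \<open>h(x) - h(0) = exp(\<psi> x / lam) P(u0,v0)(x)\<close>, so that \<open>(u0,v0)\<close> lies outside \<open>S\<close> exactly when \<open>h\<close> is not
  constant on \<open>[0,1]\<close>, and the input has no influence on \<open>h\<close> there. On the other hand
  \<open>G(x - lam t)\<close> equals \<open>G(- lam t)\<close> plus an integral of \<open>u[t]\<close>; therefore \<open>h\<close> differs from a constant depending on
  \<open>t\<close> only by terms bounded, as \<open>\<psi> \<ge> 0\<close>, by the norms of \<open>u[t]\<close> and \<open>v[t]\<close>. If these norms tended to zero, \<open>h\<close> would be
  constant (\<open>conserved_profile_constant_if_vanishing\<close>). The constant cannot be dispensed with: it contains the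
  boundary trace of \<open>v\<close> at \<open>x = 0\<close>, which convergence in \<open>L\<^sup>2\<close> does not control.

  The larger part of the work is to place the formula in the function spaces. Members of \<open>H\<^sup>1(0,1)\<close> are the integrals
  of square integrable functions (\<open>weak_imp_has_L2_deriv\<close>, \<open>has_L2_deriv_imp_weak\<close>), with a derivative that is unique up to
  null sets (\<open>has_L2_deriv_unique\<close>). Continuity and differentiability of \<open>t \<mapsto> u[t]\<close> are the statements that translation is
  continuous in \<open>L\<^sup>2\<close> and that difference quotients of an \<open>H\<^sup>1\<close> function converge to its derivative in \<open>L\<^sup>2\<close>
  (\<open>translation_continuous_L2\<close>, \<open>difference_quotient_tendsto_L2\<close>); both follow from the density of polynomials. Uniqueness
  is an energy estimate, based on integration by parts in \<open>H\<^sup>1\<close> (\<open>solution_unique\<close>).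
\<close>

section \<open>Square integrable functions on an interval\<close>

text \<open>
  Square integrability is phrased with the gauge integral because integrals over varying subintervals
  and translations are then directly available. Integrability of \<open>f\<close> provides measurability, and the
  bound \<open>2 * \<bar>f * g\<bar> \<le> f\<^sup>2 + g\<^sup>2\<close> then makes \<open>f\<close> and all products absolutely integrable, so that on
  \<open>[0,1]\<close> the notion agrees with membership in \<open>L2\<close>.
\<close>

definition sq_integrable :: "real \<Rightarrow> real \<Rightarrow> (real \<Rightarrow> real) \<Rightarrow> bool" where
  "sq_integrable a b f \<longleftrightarrow> f integrable_on {a..b} \<and> (\<lambda>x. (f x)\<^sup>2) integrable_on {a..b}"

text \<open>
  The squared \<open>L\<^sup>2\<close> norm. Working with squares, the triangle inequality is replaced by
  \<open>(f + g)\<^sup>2 \<le> 2 * f\<^sup>2 + 2 * g\<^sup>2\<close>, which is enough for every limit below.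
\<close>

definition energy :: "real \<Rightarrow> real \<Rightarrow> (real \<Rightarrow> real) \<Rightarrow> real" where
  "energy a b f = integral {a..b} (\<lambda>x. (f x)\<^sup>2)"

lemma sq_integrableD:
  assumes "sq_integrable a b f"
  shows "f integrable_on {a..b}" "(\<lambda>x. (f x)\<^sup>2) integrable_on {a..b}"
  using assms by (auto simp: sq_integrable_def)

lemma two_abs_mult_le: "2 * \<bar>x * y\<bar> \<le> x\<^sup>2 + (y::real)\<^sup>2"
  using sum_squares_bound[of "\<bar>x\<bar>" "\<bar>y\<bar>"] by (simp add: abs_mult)

lemma sq_integrable_mult:
  assumes "sq_integrable a b f" "sq_integrable a b g"
  shows "(\<lambda>x. f x * g x) absolutely_integrable_on {a..b}"
proof (rule measurable_bounded_by_integrable_imp_absolutely_integrable)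
  show "(\<lambda>x. f x * g x) \<in> borel_measurable (lebesgue_on {a..b})"
    using assms by (intro borel_measurable_times integrable_imp_measurable) (auto simp: sq_integrable_def)
  show "(\<lambda>x. (f x)\<^sup>2 + (g x)\<^sup>2) integrable_on {a..b}"
    using assms by (intro integrable_add) (auto simp: sq_integrable_def)
  show "norm (f x * g x) \<le> (f x)\<^sup>2 + (g x)\<^sup>2" for x
    using two_abs_mult_le[of "f x" "g x"] by simp
qed simp

lemma sq_integrable_continuous:
  assumes "continuous_on {a..b} f"
  shows "sq_integrable a b f"
  unfolding sq_integrable_def
  by (intro conjI integrable_continuous_interval continuous_intros assms)

lemma sq_integrable_mult_integrable:
  assumes "sq_integrable a b f" "sq_integrable a b g"
  shows "(\<lambda>x. f x * g x) integrable_on {a..b}"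
  using sq_integrable_mult[OF assms] by (simp add: absolutely_integrable_on_def)

lemma sq_integrable_abs_integrable:
  assumes "sq_integrable a b f"
  shows "(\<lambda>x. \<bar>f x\<bar>) integrable_on {a..b}" "f absolutely_integrable_on {a..b}"
  using sq_integrable_mult[OF assms sq_integrable_continuous[of a b "\<lambda>_. 1"]]
  by (simp_all add: absolutely_integrable_on_def)

lemma sq_integrable_abs:
  assumes "sq_integrable a b f"
  shows "sq_integrable a b (\<lambda>x. \<bar>f x\<bar>)"
  using assms sq_integrable_abs_integrable(1)[OF assms] by (simp add: sq_integrable_def)

lemma sq_integrable_add:
  assumes f: "sq_integrable a b f" and g: "sq_integrable a b g"
  shows "sq_integrable a b (\<lambda>x. f x + g x)"
proof -
  have "(\<lambda>x. (f x)\<^sup>2 + (g x)\<^sup>2 + 2 * (f x * g x)) integrable_on {a..b}"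
    by (intro integrable_add integrable_on_mult_right sq_integrable_mult_integrable sq_integrableD assms)
  then show ?thesis
    using assms by (auto simp: sq_integrable_def power2_sum integrable_add algebra_simps)
qed

lemma sq_integrable_cmult:
  assumes "sq_integrable a b f"
  shows "sq_integrable a b (\<lambda>x. c * f x)"
  using assms by (auto simp: sq_integrable_def power_mult_distrib intro!: integrable_on_mult_right)

lemma sq_integrable_diff:
  assumes "sq_integrable a b f" "sq_integrable a b g"
  shows "sq_integrable a b (\<lambda>x. f x - g x)"
  using sq_integrable_add[OF assms(1) sq_integrable_cmult[OF assms(2), of "-1"]] by simp

lemma sq_integrable_subinterval:
  assumes "sq_integrable a b f" "a \<le> c" "d \<le> b"
  shows "sq_integrable c d f"
  using assms integrable_on_subinterval[of f "{a..b}" c d]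
     integrable_on_subinterval[of "\<lambda>x. (f x)\<^sup>2" "{a..b}" c d]
  by (auto simp: sq_integrable_def)

lemma sq_integrable_spike:
  assumes "sq_integrable a b f" "\<And>x. a < x \<Longrightarrow> x < b \<Longrightarrow> g x = f x"
  shows "sq_integrable a b g"
  using integrable_spike_finite[OF _ _ sq_integrableD(1)[OF assms(1)], of "{a,b}" g]
    integrable_spike_finite[OF _ _ sq_integrableD(2)[OF assms(1)], of "{a,b}" "\<lambda>x. (g x)\<^sup>2"]
  by (auto simp: sq_integrable_def assms(2))

lemma sq_integrable_combine:
  assumes "sq_integrable a b f" "sq_integrable b c f" "a \<le> b" "b \<le> c"
  shows "sq_integrable a c f"
  using assms by (auto simp: sq_integrable_def intro: Henstock_Kurzweil_Integration.integrable_combine)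

lemma sq_integrable_shift:
  "sq_integrable a b (\<lambda>x. f (x + c)) \<longleftrightarrow> sq_integrable (a + c) (b + c) f"
  using integrable_shift_real_ivl_iff[of f c "a + c" "b + c"]
    integrable_shift_real_ivl_iff[of "\<lambda>x. (f x)\<^sup>2" c "a + c" "b + c"]
  by (simp add: sq_integrable_def)

lemma energy_shift: "energy a b (\<lambda>x. f (x + c)) = energy (a + c) (b + c) f"
  using integral_shift_real_ivl[of "a + c" c "b + c" "\<lambda>x. (f x)\<^sup>2"] by (simp add: energy_def)

lemma energy_nonneg [simp]: "energy a b f \<ge> 0"
  unfolding energy_def
  by (metis integral_nonneg not_integrable_integral order_refl zero_le_power2)

lemma energy_cmult: "energy a b (\<lambda>x. c * f x) = c\<^sup>2 * energy a b f"
  by (simp add: energy_def power_mult_distrib)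

lemma energy_add_le:
  assumes "sq_integrable a b f" "sq_integrable a b g"
  shows "energy a b (\<lambda>x. f x + g x) \<le> 2 * energy a b f + 2 * energy a b g"
proof -
  have "energy a b (\<lambda>x. f x + g x) \<le> integral {a..b} (\<lambda>x. 2 * (f x)\<^sup>2 + 2 * (g x)\<^sup>2)"
    unfolding energy_def
  proof (rule integral_le)
    show "(f x + g x)\<^sup>2 \<le> 2 * (f x)\<^sup>2 + 2 * (g x)\<^sup>2" for x
      using two_abs_mult_le[of "f x" "g x"] by (simp add: power2_sum)
  qed (use assms sq_integrable_add[OF assms] in
      \<open>auto intro!: integrable_add integrable_on_mult_right dest: sq_integrableD\<close>)
  also have "\<dots> = 2 * energy a b f + 2 * energy a b g"
    unfolding energy_def
    by (subst integral_add) (use assms in \<open>auto intro!: integrable_on_mult_right dest: sq_integrableD\<close>)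
  finally show ?thesis .
qed

lemma energy_mono:
  assumes "sq_integrable a b f" "sq_integrable a b g" "\<And>x. x \<in> {a..b} \<Longrightarrow> \<bar>f x\<bar> \<le> \<bar>g x\<bar>"
  shows "energy a b f \<le> energy a b g"
  unfolding energy_def
  by (rule integral_le) (use assms in \<open>auto dest: sq_integrableD simp: abs_le_square_iff\<close>)

lemma energy_le_const:
  assumes "sq_integrable a b f" "\<And>x. x \<in> {a..b} \<Longrightarrow> \<bar>f x\<bar> \<le> c" "a \<le> b"
  shows "energy a b f \<le> c\<^sup>2 * (b - a)"
proof -
  have "energy a b f \<le> energy a b (\<lambda>_. c)"
    by (rule energy_mono) (use assms in \<open>force intro!: sq_integrable_continuous\<close>)+
  then show ?thesis using assms(3) by (simp add: energy_def mult.commute)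
qed

lemma energy_subinterval:
  assumes "sq_integrable a b f" "a \<le> c" "d \<le> b"
  shows "energy c d f \<le> energy a b f"
  unfolding energy_def
  by (rule integral_subset_le)
    (use assms in \<open>auto dest: sq_integrableD sq_integrable_subinterval\<close>)

text \<open>
  The quadratic polynomial \<open>s \<mapsto> \<integral> (f + s * g)\<^sup>2\<close> is nonnegative; evaluating it at its minimum gives the
  inequality. When \<open>g\<close> vanishes almost everywhere the polynomial is affine, hence constant.
\<close>

lemma Cauchy_Schwarz_integral:
  assumes f: "sq_integrable a b f" and g: "sq_integrable a b g"
  shows "(integral {a..b} (\<lambda>x. f x * g x))\<^sup>2 \<le> energy a b f * energy a b g"
proof -
  define B where "B = integral {a..b} (\<lambda>x. f x * g x)"
  have ineq: "0 \<le> energy a b f + 2 * s * B + s\<^sup>2 * energy a b g" for s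
  proof -
    have "energy a b (\<lambda>x. f x + s * g x)
        = integral {a..b} (\<lambda>x. (f x)\<^sup>2 + ((2 * s) * (f x * g x) + s\<^sup>2 * (g x)\<^sup>2))"
      unfolding energy_def by (simp add: power2_eq_square algebra_simps)
    also have "\<dots> = energy a b f + 2 * s * B + s\<^sup>2 * energy a b g"
      unfolding energy_def B_def using f g
      by (subst integral_add | simp add: integrable_add sq_integrableD sq_integrable_mult_integrable
           integrable_on_mult_right del: integrable_on_cmult_left_iff)+
    finally show ?thesis using energy_nonneg by metis
  qed
  show ?thesis
  proof (cases "energy a b g = 0")
    case False
    then have "energy a b g > 0" using energy_nonneg[of a b g] by linarith
    then show ?thesis
      using ineq[of "- B / energy a b g"] unfolding B_def[symmetric]
      by (simp add: field_simps power2_eq_square)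
  next
    case True
    have "B = 0"
    proof (rule ccontr)
      assume "B \<noteq> 0"
      then show False using ineq[of "- (energy a b f + 1) / (2 * B)"] True by (simp add: field_simps)
    qed
    then show ?thesis by (simp add: B_def)
  qed
qed

lemma integral_sq_le_energy:
  assumes "sq_integrable a b f" "a \<le> b"
  shows "(integral {a..b} f)\<^sup>2 \<le> (b - a) * energy a b f"
  using Cauchy_Schwarz_integral[OF assms(1) sq_integrable_continuous[of a b "\<lambda>_. 1"]] assms(2)
  by (simp add: energy_def mult.commute)

lemma L2_iff_sq_integrable: "f \<in> L2 \<longleftrightarrow> sq_integrable 0 1 f"
proof
  assume f: "f \<in> L2"
  then have m: "f \<in> borel_measurable (lebesgue_on {0..1})"
    and i: "(\<lambda>x. (f x)\<^sup>2) integrable_on {0..1}"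
    using integrable_on_lebesgue_on[of "{0..1}" "\<lambda>x. \<bar>f x\<bar>\<^sup>2"] by (auto simp: L2_def)
  have "f integrable_on {0..1}"
  proof (rule measurable_bounded_by_integrable_imp_integrable[OF m])
    show "(\<lambda>x. (f x)\<^sup>2 + 1) integrable_on {0..1}" using i by (intro integrable_add) auto
    show "norm (f x) \<le> (f x)\<^sup>2 + 1" for x
      using two_abs_mult_le[of "f x" 1] by (simp)
  qed auto
  then show "sq_integrable 0 1 f" using i by (simp add: sq_integrable_def)
next
  assume f: "sq_integrable 0 1 f"
  have "(\<lambda>x. f x * f x) absolutely_integrable_on {0..1}"
    by (rule sq_integrable_mult[OF f f])
  then show "f \<in> L2"
    using integrable_imp_measurable[OF sq_integrableD(1)[OF f]] absolutely_integrable_imp_integrable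
    by (fastforce simp: L2_def power2_eq_square)
qed

lemma norm2_eq_energy:
  assumes "sq_integrable 0 1 f"
  shows "norm2 f = sqrt (energy 0 1 f)"
proof -
  have "integrable (lebesgue_on {0..1}) (\<lambda>x. \<bar>f x\<bar>\<^sup>2)"
    using assms unfolding L2_iff_sq_integrable[symmetric] by (simp add: L2_def)
  then show ?thesis
    using lebesgue_integral_eq_integral[of "{0..1}" "\<lambda>x. \<bar>f x\<bar>\<^sup>2"] by (simp add: norm2_def energy_def)
qed

lemma lebesgue_integral_mult_eq:
  assumes "sq_integrable 0 1 f" "sq_integrable 0 1 g"
  shows "(\<integral>x. f x * g x \<partial>lebesgue_on {0..1}) = integral {0..1} (\<lambda>x. f x * g x)"
  using absolutely_integrable_imp_integrable[OF sq_integrable_mult[OF assms]]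
  by (intro lebesgue_integral_eq_integral) auto

lemma norm2_tendsto_0_iff:
  assumes "\<forall>\<^sub>F s in F. sq_integrable 0 1 (f s)"
  shows "((\<lambda>s. norm2 (f s)) \<longlongrightarrow> 0) F \<longleftrightarrow> ((\<lambda>s. energy 0 1 (f s)) \<longlongrightarrow> 0) F"
proof -
  have "((\<lambda>s. norm2 (f s)) \<longlongrightarrow> 0) F \<longleftrightarrow> ((\<lambda>s. sqrt (energy 0 1 (f s))) \<longlongrightarrow> 0) F"
    by (rule tendsto_cong) (use assms in \<open>auto elim!: eventually_mono simp: norm2_eq_energy\<close>)
  also have "\<dots> \<longleftrightarrow> ((\<lambda>s. energy 0 1 (f s)) \<longlongrightarrow> 0) F"
    using tendsto_real_sqrt[of "\<lambda>s. energy 0 1 (f s)" 0 F] 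
      tendsto_power[of "\<lambda>s. sqrt (energy 0 1 (f s))" 0 F 2] by auto
  finally show ?thesis .
qed

section \<open>Density of polynomials\<close>

lemma bounded_measurable_imp_sq_integrable:
  assumes "f \<in> borel_measurable (lebesgue_on {a..b})" "\<And>x. \<bar>f x\<bar> \<le> M"
  shows "sq_integrable a b f"
  unfolding sq_integrable_def
proof
  show "f integrable_on {a..b}"
    by (rule measurable_bounded_by_integrable_imp_integrable[OF assms(1), of "\<lambda>_. M"]) (use assms(2) in auto)
  have "M \<ge> 0" using assms(2)[of 0] by linarith
  show "(\<lambda>x. (f x)\<^sup>2) integrable_on {a..b}"
    by (rule measurable_bounded_by_integrable_imp_integrable[of _ _ "\<lambda>_. M\<^sup>2"])
      (use assms \<open>M \<ge> 0\<close> in \<open>auto simp: power2_le_iff_abs_le\<close>)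
qed

lemma energy_diff_le:
  assumes "sq_integrable a b (\<lambda>x. f x - g x)" "sq_integrable a b (\<lambda>x. g x - h x)"
  shows "energy a b (\<lambda>x. f x - h x) \<le> 2 * energy a b (\<lambda>x. f x - g x) + 2 * energy a b (\<lambda>x. g x - h x)"
  using energy_add_le[OF assms] by simp

text \<open>
  Three approximations are composed: \<open>f\<close> is truncated at height \<open>M\<close>; a measurable function is an almost
  everywhere limit of continuous ones, and truncating those at the same height makes dominated convergence
  applicable; finally the Weierstrass theorem replaces the continuous function by a polynomial.
\<close>

lemma polynomials_dense_L2:
  assumes f: "sq_integrable a b f" and "e > 0" "a \<le> b"
  obtains p where "real_polynomial_function p" "energy a b (\<lambda>x. f x - p x) < e"
proof -
  define cut where "cut M y = max (- real M) (min (real M) y)" for M :: nat and y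
  have cont_cut: "continuous_on A (\<lambda>x. cut M (h x))" if "continuous_on A h" for M A and h :: "real \<Rightarrow> real"
    unfolding cut_def by (intro continuous_intros that)
  have cut_bound: "\<bar>cut M y\<bar> \<le> real M" for M y by (auto simp: cut_def)
  have mf: "f \<in> borel_measurable (lebesgue_on {a..b})"
    using integrable_imp_measurable[OF sq_integrableD(1)[OF f]] .
  have cut_f: "sq_integrable a b (\<lambda>x. cut M (f x))" for M
    by (rule bounded_measurable_imp_sq_integrable[of _ _ _ "real M"]) (use mf cut_bound in \<open>auto simp: cut_def\<close>)
  have "(\<lambda>M. energy a b (\<lambda>x. f x - cut M (f x))) \<longlonglongrightarrow> integral {a..b} (\<lambda>x. 0)"
    unfolding energy_def
  proof (rule dominated_convergence(2))
    show "(\<lambda>x. (f x - cut M (f x))\<^sup>2) integrable_on {a..b}" for M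
      using sq_integrable_diff[OF f cut_f] by (rule sq_integrableD)
    show "(\<lambda>x. (f x)\<^sup>2) integrable_on {a..b}" using f by (rule sq_integrableD)
    show "norm ((f x - cut M (f x))\<^sup>2) \<le> (f x)\<^sup>2" for M x
    proof -
      have "\<bar>f x - cut M (f x)\<bar> \<le> \<bar>f x\<bar>" by (auto simp: cut_def)
      then show ?thesis by (simp add: abs_le_square_iff)
    qed
    show "(\<lambda>M. (f x - cut M (f x))\<^sup>2) \<longlonglongrightarrow> 0" for x
    proof (rule tendsto_eventually)
      obtain M0 :: nat where "\<bar>f x\<bar> \<le> real M0" using real_arch_simple by blast
      then have "cut M (f x) = f x" if "M \<ge> M0" for M
        using of_nat_mono[OF that, where 'a=real] by (simp add: cut_def)
      then have "\<forall>\<^sub>F M in sequentially. cut M (f x) = f x"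
        by (rule eventually_sequentiallyI)
      then show "\<forall>\<^sub>F M in sequentially. (f x - cut M (f x))\<^sup>2 = 0"
        by eventually_elim simp
    qed
  qed
  then have "\<forall>\<^sub>F M in sequentially. energy a b (\<lambda>x. f x - cut M (f x)) < e / 8"
    using \<open>e > 0\<close> by (intro order_tendstoD) auto
  then obtain M where M: "energy a b (\<lambda>x. f x - cut M (f x)) < e / 8"
    using eventually_happens'[OF sequentially_bot] by blast
  have "f measurable_on {a..b}" using mf by (simp add: measurable_on_iff_borel_measurable)
  then obtain N g where N: "negligible N" and g: "\<And>n. continuous_on UNIV (g n)"
     and lim: "\<And>x. x \<notin> N \<Longrightarrow> (\<lambda>n. g n x) \<longlonglongrightarrow> (if x \<in> {a..b} then f x else 0)"
    unfolding measurable_on_def by blast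
  have cut_g: "sq_integrable a b (\<lambda>x. cut M (g n x))" for n
    by (intro sq_integrable_continuous cont_cut continuous_on_subset[OF g]) auto
  \<comment> \<open>The squared error, set to zero on the exceptional null set so that it converges pointwise everywhere.\<close>
  define h where "h n x = (if x \<in> N then 0 else (cut M (f x) - cut M (g n x))\<^sup>2)" for n x
  have h_eq: "energy a b (\<lambda>x. cut M (f x) - cut M (g n x)) = integral {a..b} (h n)" for n
    unfolding energy_def by (rule integral_spike[OF N]) (auto simp: h_def)
  have "(\<lambda>n. integral {a..b} (h n)) \<longlonglongrightarrow> integral {a..b} (\<lambda>x. 0)"
  proof (rule dominated_convergence(2))
    show "h n integrable_on {a..b}" for n
      by (rule integrable_spike[OF sq_integrableD(2)[OF sq_integrable_diff[OF cut_f[of M] cut_g[of n]]] N])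
        (auto simp: h_def)
    show "(\<lambda>x. (2 * real M)\<^sup>2) integrable_on {a..b}" by (rule integrable_const_ivl)
    show "norm (h n x) \<le> (2 * real M)\<^sup>2" for n x
    proof -
      have "\<bar>cut M (f x) - cut M (g n x)\<bar> \<le> 2 * real M"
        using cut_bound[of M "f x"] cut_bound[of M "g n x"] by linarith
      then have "(cut M (f x) - cut M (g n x))\<^sup>2 \<le> (2 * real M)\<^sup>2"
        by (subst power2_le_iff_abs_le) auto
      then show ?thesis by (simp add: h_def)
    qed
    show "(\<lambda>n. h n x) \<longlonglongrightarrow> 0" if "x \<in> {a..b}" for x
    proof (cases "x \<in> N")
      case False
      then have "(\<lambda>n. g n x) \<longlonglongrightarrow> f x" using lim[OF False] that by simp
      then have "(\<lambda>n. (cut M (f x) - cut M (g n x))\<^sup>2) \<longlonglongrightarrow> (cut M (f x) - cut M (f x))\<^sup>2"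
        unfolding cut_def by (intro tendsto_intros)
      then show ?thesis using False by (simp add: h_def)
    qed (simp add: h_def)
  qed
  then have "\<forall>\<^sub>F n in sequentially. integral {a..b} (h n) < e / 16"
    using \<open>e > 0\<close> by (intro order_tendstoD) auto
  then obtain n where n: "energy a b (\<lambda>x. cut M (f x) - cut M (g n x)) < e / 16"
    unfolding h_eq using eventually_happens'[OF sequentially_bot] by blast
  define d where "d = sqrt (e / (16 * (b - a + 1)))"
  have d: "d > 0" "d\<^sup>2 * (b - a) \<le> e / 16"
    using \<open>e > 0\<close> \<open>a \<le> b\<close> by (auto simp: d_def field_simps)
  have "continuous_on {a..b} (\<lambda>x. cut M (g n x))"
    by (intro cont_cut continuous_on_subset[OF g]) auto
  then obtain p where p: "real_polynomial_function p" "\<And>x. x \<in> {a..b} \<Longrightarrow> \<bar>cut M (g n x) - p x\<bar> < d"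
    using Stone_Weierstrass_real_polynomial_function[OF compact_Icc _ d(1)] by blast
  have cp: "sq_integrable a b p"
    using p(1) by (intro sq_integrable_continuous continuous_on_polymonial_function) (simp add: real_polynomial_function_eq)
  have "energy a b (\<lambda>x. cut M (g n x) - p x) \<le> d\<^sup>2 * (b - a)"
    using p(2) \<open>a \<le> b\<close> by (intro energy_le_const sq_integrable_diff cut_g cp) (auto simp: less_imp_le)
  moreover have "energy a b (\<lambda>x. cut M (f x) - p x) \<le> 2 * energy a b (\<lambda>x. cut M (f x) - cut M (g n x))
       + 2 * energy a b (\<lambda>x. cut M (g n x) - p x)"
    by (intro energy_diff_le sq_integrable_diff cut_f cut_g cp)
  moreover have "energy a b (\<lambda>x. f x - p x) \<le> 2 * energy a b (\<lambda>x. f x - cut M (f x))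
       + 2 * energy a b (\<lambda>x. cut M (f x) - p x)"
    by (intro energy_diff_le sq_integrable_diff cut_f f cp)
  ultimately have "energy a b (\<lambda>x. f x - p x) < e" using M n d(2) \<open>e > 0\<close> by linarith
  then show ?thesis using that p(1) by blast
qed

section \<open>Absolutely continuous functions with square integrable derivative\<close>

text \<open>
  Absolute continuity on \<open>[a,b]\<close> with a square integrable derivative, written as the fundamental theorem of
  calculus. On \<open>[0,1]\<close> this is a concrete description of \<open>H\<^sup>1\<close>, stable under gluing and translation.
\<close>

definition has_L2_deriv :: "real \<Rightarrow> real \<Rightarrow> (real \<Rightarrow> real) \<Rightarrow> (real \<Rightarrow> real) \<Rightarrow> bool" where
  "has_L2_deriv a b f g \<longleftrightarrow> sq_integrable a b g \<and>
     (\<forall>x y. a \<le> x \<longrightarrow> x \<le> y \<longrightarrow> y \<le> b \<longrightarrow> f y - f x = integral {x..y} g)"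

lemma has_L2_derivD:
  assumes "has_L2_deriv a b f g"
  shows "sq_integrable a b g" "\<And>x y. a \<le> x \<Longrightarrow> x \<le> y \<Longrightarrow> y \<le> b \<Longrightarrow> f y - f x = integral {x..y} g"
  using assms by (auto simp: has_L2_deriv_def)

lemma has_L2_deriv_continuous:
  assumes "has_L2_deriv a b f g"
  shows "continuous_on {a..b} f"
proof -
  have "continuous_on {a..b} (\<lambda>x. f a + integral {a..x} g)"
    by (intro continuous_intros indefinite_integral_continuous_1 sq_integrableD has_L2_derivD[OF assms])
  then show ?thesis
    by (rule continuous_on_eq) (use has_L2_derivD(2)[OF assms, of a] in force)
qed

lemma has_L2_deriv_add:
  assumes "has_L2_deriv a b f g" "has_L2_deriv a b f' g'"
  shows "has_L2_deriv a b (\<lambda>x. f x + f' x) (\<lambda>x. g x + g' x)"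
  unfolding has_L2_deriv_def
proof (intro conjI allI impI)
  note D = has_L2_derivD[OF assms(1)] has_L2_derivD[OF assms(2)]
  show "sq_integrable a b (\<lambda>x. g x + g' x)" using D by (intro sq_integrable_add)
  fix x y assume xy: "a \<le> x" "x \<le> y" "y \<le> b"
  have "g integrable_on {x..y}" "g' integrable_on {x..y}"
    using sq_integrableD(1)[OF sq_integrable_subinterval[OF D(1) xy(1,3)]]
      sq_integrableD(1)[OF sq_integrable_subinterval[OF D(3) xy(1,3)]] by auto
  then show "f y + f' y - (f x + f' x) = integral {x..y} (\<lambda>x. g x + g' x)"
    using D(2)[OF xy] D(4)[OF xy] by (simp add: integral_add)
qed

lemma has_L2_deriv_cmult:
  assumes "has_L2_deriv a b f g"
  shows "has_L2_deriv a b (\<lambda>x. c * f x) (\<lambda>x. c * g x)"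
  using assms by (auto simp: has_L2_deriv_def sq_integrable_cmult right_diff_distrib[symmetric])

lemma has_L2_deriv_diff:
  assumes "has_L2_deriv a b f g" "has_L2_deriv a b f' g'"
  shows "has_L2_deriv a b (\<lambda>x. f x - f' x) (\<lambda>x. g x - g' x)"
  using has_L2_deriv_add[OF assms(1) has_L2_deriv_cmult[OF assms(2), of "-1"]] by simp

lemma has_L2_deriv_subinterval:
  assumes "has_L2_deriv a b f g" "a \<le> c" "d \<le> b"
  shows "has_L2_deriv c d f g"
  using assms sq_integrable_subinterval[of a b g c d] by (auto simp: has_L2_deriv_def)

lemma has_L2_deriv_shift:
  assumes "has_L2_deriv (a + c) (b + c) f g"
  shows "has_L2_deriv a b (\<lambda>x. f (x + c)) (\<lambda>x. g (x + c))"
  unfolding has_L2_deriv_def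
proof (intro conjI allI impI)
  show "sq_integrable a b (\<lambda>x. g (x + c))" using assms by (simp add: sq_integrable_shift has_L2_deriv_def)
  fix x y assume "a \<le> x" "x \<le> y" "y \<le> b"
  then show "f (y + c) - f (x + c) = integral {x..y} (\<lambda>x. g (x + c))"
    using assms integral_shift_real_ivl[of "x + c" c "y + c" g] by (simp add: has_L2_deriv_def)
qed

lemma has_L2_deriv_spike:
  assumes D: "has_L2_deriv a b f g" and "\<And>x. a < x \<Longrightarrow> x < b \<Longrightarrow> g' x = g x"
     "\<And>x. a \<le> x \<Longrightarrow> x \<le> b \<Longrightarrow> f' x = f x"
  shows "has_L2_deriv a b f' g'"
  unfolding has_L2_deriv_def
proof (intro conjI allI impI)
  show "sq_integrable a b g'" by (rule sq_integrable_spike[OF has_L2_derivD(1)[OF D] assms(2)])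
  fix x y assume xy: "a \<le> x" "x \<le> y" "y \<le> b"
  have "integral {x..y} g = integral {x..y} g'"
    by (rule integral_spike[of "{x,y}"]) (use xy assms(2) in auto)
  then show "f' y - f' x = integral {x..y} g'" using has_L2_derivD(2)[OF D xy] xy by (simp add: assms(3))
qed

lemma has_L2_deriv_combine:
  assumes "has_L2_deriv a b f g" "has_L2_deriv b c f g" "a \<le> b" "b \<le> c"
  shows "has_L2_deriv a c f g"
  unfolding has_L2_deriv_def
proof (intro conjI allI impI)
  note D = has_L2_derivD[OF assms(1)] has_L2_derivD[OF assms(2)]
  show sq: "sq_integrable a c g" using D assms by (intro sq_integrable_combine[of a b g c])
  fix x y assume xy: "a \<le> x" "x \<le> y" "y \<le> c"
  consider "y \<le> b" | "b \<le> x" | "x \<le> b" "b \<le> y" by linarith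
  then show "f y - f x = integral {x..y} g"
  proof cases
    case 3
    have "g integrable_on {x..y}" using sq_integrableD(1)[OF sq_integrable_subinterval[OF sq xy(1,3)]] .
    then have "integral {x..b} g + integral {b..y} g = integral {x..y} g"
      by (rule Henstock_Kurzweil_Integration.integral_combine[OF 3])
    then show ?thesis using D(2)[of x b] D(4)[of b y] 3 xy by simp
  qed (use D xy in auto)
qed

lemma has_L2_deriv_C1:
  assumes "continuous_on {a..b} f'" "\<And>x. x \<in> {a..b} \<Longrightarrow> (f has_real_derivative f' x) (at x within {a..b})"
  shows "has_L2_deriv a b f f'"
  unfolding has_L2_deriv_def
proof (intro conjI allI impI)
  show "sq_integrable a b f'" by (rule sq_integrable_continuous[OF assms(1)])
  fix x y assume xy: "a \<le> x" "x \<le> y" "y \<le> b"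
  have "(f' has_integral f y - f x) {x..y}"
    using xy by (intro fundamental_theorem_of_calculus)
      (auto simp flip: has_real_derivative_iff_has_vector_derivative intro: DERIV_subset[OF assms(2)])
  then show "f y - f x = integral {x..y} f'" by (simp add: integral_unique)
qed

text \<open>
  Dividing by \<open>y - x\<close> and using the continuity of \<open>M\<close> shows that \<open>Q\<close> has derivative zero everywhere.
\<close>

lemma constant_if_superlinear_increments:
  fixes Q M :: "real \<Rightarrow> real"
  assumes bound: "\<And>x y. a \<le> x \<Longrightarrow> x \<le> y \<Longrightarrow> y \<le> b \<Longrightarrow> \<bar>Q y - Q x\<bar> \<le> (y - x) * (M y - M x)"
    and M: "continuous_on {a..b} M" and "a \<le> b"
  shows "Q b = Q a"
proof -
  have "(Q has_real_derivative 0) (at x within {a..b})" if x: "x \<in> {a..b}" for x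
    unfolding has_field_derivative_iff
  proof (rule Lim_null_comparison)
    show "\<forall>\<^sub>F y in at x within {a..b}. norm ((Q y - Q x) / (y - x)) \<le> \<bar>M y - M x\<bar>"
      unfolding eventually_at_filter
    proof (intro always_eventually allI impI)
      fix y assume y: "y \<noteq> x" "y \<in> {a..b}"
      have "\<bar>Q y - Q x\<bar> \<le> \<bar>y - x\<bar> * \<bar>M y - M x\<bar>"
      proof (cases "x \<le> y")
        case True
        then have "\<bar>Q y - Q x\<bar> \<le> (y - x) * (M y - M x)" using bound x y by auto
        also have "\<dots> \<le> \<bar>y - x\<bar> * \<bar>M y - M x\<bar>" by (metis abs_ge_self abs_mult)
        finally show ?thesis .
      next
        case False
        then have "\<bar>Q x - Q y\<bar> \<le> (x - y) * (M x - M y)" using bound x y by auto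
        also have "\<dots> \<le> \<bar>x - y\<bar> * \<bar>M x - M y\<bar>" by (metis abs_ge_self abs_mult)
        finally show ?thesis by (simp add: abs_minus_commute)
      qed
      then show "norm ((Q y - Q x) / (y - x)) \<le> \<bar>M y - M x\<bar>"
        using y by (simp add: field_simps)
    qed
    have "(M \<longlongrightarrow> M x) (at x within {a..b})" using M x by (simp add: continuous_on_def)
    then show "((\<lambda>y. \<bar>M y - M x\<bar>) \<longlongrightarrow> 0) (at x within {a..b})"
      using LIM_zero tendsto_rabs_zero by blast
  qed
  then obtain c where "\<And>x. x \<in> {a..b} \<Longrightarrow> Q x = c"
    using has_field_derivative_zero_constant[of "{a..b}" Q] by auto
  then show ?thesis using \<open>a \<le> b\<close> by simp
qed

text \<open>
  The functions need not be differentiable at every point, so the product rule is not available. Instead let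
  \<open>Q x = f1 x * f2 x - \<integral>\<^sub>a\<^sup>x (g1 * f2 + f1 * g2)\<close>. Its increment over \<open>[x,y]\<close> equals
  \<open>\<integral> g1 s * (f2 y - f2 s) + (f1 x - f1 s) * g2 s\<close>, which is at most \<open>2 * \<integral>\<bar>g1\<bar> * \<integral>\<bar>g2\<bar>\<close>; by the
  Cauchy-Schwarz inequality this is bounded by \<open>y - x\<close> times the increment of \<open>\<integral> (g1\<^sup>2 + g2\<^sup>2)\<close>. Such a \<open>Q\<close> is constant.
\<close>

lemma integral_by_parts_L2_deriv:
  assumes D1: "has_L2_deriv a b f1 g1" and D2: "has_L2_deriv a b f2 g2" and "a \<le> b"
  shows "integral {a..b} (\<lambda>x. g1 x * f2 x + f1 x * g2 x) = f1 b * f2 b - f1 a * f2 a"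
proof -
  note g1 = has_L2_derivD(1)[OF D1] and g2 = has_L2_derivD(1)[OF D2]
  have f1: "sq_integrable a b f1" and f2: "sq_integrable a b f2"
    using D1 D2 has_L2_deriv_continuous sq_integrable_continuous by blast+
  define r where "r = (\<lambda>x. g1 x * f2 x + f1 x * g2 x)"
  define M where "M = (\<lambda>x. integral {a..x} (\<lambda>s. (g1 s)\<^sup>2 + (g2 s)\<^sup>2))"
  define Q where "Q = (\<lambda>x. f1 x * f2 x - integral {a..x} r)"
  have r: "r integrable_on {a..b}"
    unfolding r_def by (intro integrable_add sq_integrable_mult_integrable f1 f2 g1 g2)
  have m: "(\<lambda>s. (g1 s)\<^sup>2 + (g2 s)\<^sup>2) integrable_on {a..b}"
    by (intro integrable_add sq_integrableD g1 g2)
  have "Q b = Q a"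
  proof (rule constant_if_superlinear_increments[where M = M and Q = Q and a = a and b = b])
    show "continuous_on {a..b} M" unfolding M_def by (rule indefinite_integral_continuous_1[OF m])
    fix x y assume xy: "a \<le> x" "x \<le> y" "y \<le> b"
    note sub = sq_integrable_subinterval[OF _ xy(1,3)]
    note f1' = sub[OF f1] and f2' = sub[OF f2] and g1' = sub[OF g1] and g2' = sub[OF g2]
    define A1 where "A1 = integral {x..y} (\<lambda>s. \<bar>g1 s\<bar>)"
    define A2 where "A2 = integral {x..y} (\<lambda>s. \<bar>g2 s\<bar>)"
    have A0: "A1 \<ge> 0" "A2 \<ge> 0" unfolding A1_def A2_def
      using sq_integrable_abs_integrable(1)[OF g1'] sq_integrable_abs_integrable(1)[OF g2']
      by (simp_all add: integral_nonneg)
    have var: "\<bar>f t - f s\<bar> \<le> integral {x..y} (\<lambda>s. \<bar>g s\<bar>)"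
      if D: "has_L2_deriv a b f g" and st: "x \<le> s" "s \<le> t" "t \<le> y" for f g s t
    proof -
      have st': "a \<le> s" "t \<le> b" using st xy by auto
      have 1: "sq_integrable x y g" using sub[OF has_L2_derivD(1)[OF D]] .
      have 2: "sq_integrable s t g" using sq_integrable_subinterval[OF has_L2_derivD(1)[OF D] st'] .
      have "\<bar>f t - f s\<bar> = \<bar>integral {s..t} g\<bar>"
        using has_L2_derivD(2)[OF D st'(1) st(2) st'(2)] by simp
      also have "\<dots> \<le> integral {s..t} (\<lambda>s. \<bar>g s\<bar>)"
        using integral_norm_bound_integral[of g "{s..t}" "\<lambda>s. \<bar>g s\<bar>"] sq_integrableD(1)[OF 2]
          sq_integrable_abs_integrable[OF 2] by simp
      also have "\<dots> \<le> integral {x..y} (\<lambda>s. \<bar>g s\<bar>)"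
        using st sq_integrable_abs_integrable[OF 1] sq_integrable_abs_integrable[OF 2]
        by (intro integral_subset_le) auto
      finally show ?thesis .
    qed
    have i1: "(\<lambda>s. g1 s * (f2 y - f2 s)) integrable_on {x..y}"
      by (rule sq_integrable_mult_integrable[OF g1'])
        (intro sq_integrable_diff f2' sq_integrable_continuous continuous_intros)
    have i2: "(\<lambda>s. (f1 x - f1 s) * g2 s) integrable_on {x..y}"
      by (rule sq_integrable_mult_integrable[OF _ g2'])
        (intro sq_integrable_diff f1' sq_integrable_continuous continuous_intros)
    have b1: "\<bar>integral {x..y} (\<lambda>s. g1 s * (f2 y - f2 s))\<bar> \<le> A1 * A2"
    proof -
      have "norm (integral {x..y} (\<lambda>s. g1 s * (f2 y - f2 s))) \<le> integral {x..y} (\<lambda>s. \<bar>g1 s\<bar> * A2)"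
      proof (rule integral_norm_bound_integral[OF i1])
        show "(\<lambda>s. \<bar>g1 s\<bar> * A2) integrable_on {x..y}"
          using sq_integrable_abs_integrable(1)[OF g1'] by (rule integrable_on_mult_left)
        show "norm (g1 s * (f2 y - f2 s)) \<le> \<bar>g1 s\<bar> * A2" if "s \<in> {x..y}" for s
          using var[OF D2, of s y] that by (auto simp: A2_def abs_mult intro!: mult_left_mono)
      qed
      then show ?thesis by (simp add: A1_def)
    qed
    have b2: "\<bar>integral {x..y} (\<lambda>s. (f1 x - f1 s) * g2 s)\<bar> \<le> A1 * A2"
    proof -
      have "norm (integral {x..y} (\<lambda>s. (f1 x - f1 s) * g2 s)) \<le> integral {x..y} (\<lambda>s. A1 * \<bar>g2 s\<bar>)"
      proof (rule integral_norm_bound_integral[OF i2])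
        show "(\<lambda>s. A1 * \<bar>g2 s\<bar>) integrable_on {x..y}"
          using sq_integrable_abs_integrable(1)[OF g2'] by (rule integrable_on_mult_right)
        show "norm ((f1 x - f1 s) * g2 s) \<le> A1 * \<bar>g2 s\<bar>" if "s \<in> {x..y}" for s
          using var[OF D1, of x s] that
          by (auto simp: A1_def abs_mult abs_minus_commute intro!: mult_right_mono)
      qed
      then show ?thesis by (simp add: A2_def)
    qed
    have "Q y - Q x = (f1 y * f2 y - f1 x * f2 x) - integral {x..y} r"
      using Henstock_Kurzweil_Integration.integral_combine[OF xy(1,2) integrable_on_subinterval[OF r]] xy
      by (simp add: Q_def)
    also have "f1 y * f2 y - f1 x * f2 x = (f1 y - f1 x) * f2 y + f1 x * (f2 y - f2 x)"
      by (simp add: algebra_simps)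
    also have "\<dots> = integral {x..y} (\<lambda>s. g1 s * f2 y) + integral {x..y} (\<lambda>s. f1 x * g2 s)"
      using has_L2_derivD(2)[OF D1 xy] has_L2_derivD(2)[OF D2 xy] by simp
    also have "\<dots> = integral {x..y} (\<lambda>s. g1 s * f2 y + f1 x * g2 s)"
      using sq_integrableD(1)[OF g1'] sq_integrableD(1)[OF g2']
      by (intro integral_add[symmetric] integrable_on_mult_left integrable_on_mult_right)
    also have "\<dots> - integral {x..y} r = integral {x..y} (\<lambda>s. g1 s * f2 y + f1 x * g2 s - r s)"
      using sq_integrableD(1)[OF g1'] sq_integrableD(1)[OF g2'] integrable_on_subinterval[OF r, of x y] xy
      by (intro integral_diff[symmetric] integrable_add integrable_on_mult_left integrable_on_mult_right) auto
    also have "\<dots> = integral {x..y} (\<lambda>s. g1 s * (f2 y - f2 s) + (f1 x - f1 s) * g2 s)"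
      by (simp add: r_def algebra_simps)
    also have "\<dots> = integral {x..y} (\<lambda>s. g1 s * (f2 y - f2 s)) + integral {x..y} (\<lambda>s. (f1 x - f1 s) * g2 s)"
      by (rule integral_add[OF i1 i2])
    finally have "\<bar>Q y - Q x\<bar> \<le> 2 * (A1 * A2)" using b1 b2 by linarith
    also have "\<dots> \<le> A1\<^sup>2 + A2\<^sup>2" using sum_squares_bound[of A1 A2] by simp
    also have "\<dots> \<le> (y - x) * energy x y g1 + (y - x) * energy x y g2"
      using integral_sq_le_energy[OF sq_integrable_abs[OF g1'] xy(2)]
        integral_sq_le_energy[OF sq_integrable_abs[OF g2'] xy(2)]
      by (simp add: A1_def A2_def energy_def)
    also have "\<dots> = (y - x) * (energy x y g1 + energy x y g2)" by (simp add: distrib_left)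
    also have "energy x y g1 + energy x y g2 = M y - M x"
      using Henstock_Kurzweil_Integration.integral_combine[OF xy(1,2) integrable_on_subinterval[OF m]] xy
        integral_add[OF sq_integrableD(2)[OF g1'] sq_integrableD(2)[OF g2']]
      by (simp add: M_def energy_def)
    finally show "\<bar>Q y - Q x\<bar> \<le> (y - x) * (M y - M x)" .
  qed fact
  then show ?thesis by (simp add: Q_def r_def)
qed

lemma test_function_deriv:
  assumes "test_function \<phi>"
  shows "(\<phi> has_real_derivative deriv \<phi> x) (at x)" "continuous_on A (deriv \<phi>)"
proof -
  have d: "(deriv ^^ n) \<phi> field_differentiable at x" for n x using assms by (simp add: test_function_def)
  show "(\<phi> has_real_derivative deriv \<phi> x) (at x)"
    using d[of 0] by (simp add: field_differentiable_derivI)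
  show "continuous_on A (deriv \<phi>)"
    using d[of 1] field_differentiable_imp_continuous_at
    by (force intro!: continuous_at_imp_continuous_on)
qed

lemma test_function_boundary:
  assumes "test_function \<phi>" "x \<notin> {0<..<1}"
  shows "\<phi> x = 0"
  using assms closure_subset[of "{x. \<phi> x \<noteq> 0}"] unfolding test_function_def by blast

lemma test_function_has_L2_deriv: "test_function \<phi> \<Longrightarrow> has_L2_deriv a b \<phi> (deriv \<phi>)"
  by (intro has_L2_deriv_C1 test_function_deriv has_field_derivative_at_within[OF test_function_deriv(1)])

lemma has_L2_deriv_imp_weak:
  assumes D: "has_L2_deriv 0 1 f g"
  shows "has_weak_derivative f g"
  unfolding has_weak_derivative_def L2_iff_sq_integrable
proof (intro conjI allI impI)
  show g: "sq_integrable 0 1 g" using D by (rule has_L2_derivD)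
  show f: "sq_integrable 0 1 f" by (intro sq_integrable_continuous has_L2_deriv_continuous[OF D])
  fix \<phi> assume \<phi>: "test_function \<phi>"
  have s: "sq_integrable 0 1 \<phi>" "sq_integrable 0 1 (deriv \<phi>)"
    using test_function_has_L2_deriv[OF \<phi>] has_L2_derivD(1) has_L2_deriv_continuous sq_integrable_continuous
    by blast+
  have "integral {0..1} (\<lambda>x. g x * \<phi> x) + integral {0..1} (\<lambda>x. f x * deriv \<phi> x) = 0"
    using integral_by_parts_L2_deriv[OF D test_function_has_L2_deriv[OF \<phi>]]
      test_function_boundary[OF \<phi>, of 0] test_function_boundary[OF \<phi>, of 1]
    by (simp add: integral_add sq_integrable_mult_integrable f g s)
  then show "(\<integral>x. f x * deriv \<phi> x \<partial>lebesgue_on {0..1}) = - (\<integral>x. g x * \<phi> x \<partial>lebesgue_on {0..1})"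
    by (simp add: lebesgue_integral_mult_eq f g s)
qed

text \<open>
  The difference \<open>d\<close> of two derivatives has zero integral over every interval. Integration by parts makes
  it orthogonal to all polynomials, and these are dense.
\<close>

lemma has_L2_deriv_unique:
  assumes D1: "has_L2_deriv a b f g" and D2: "has_L2_deriv a b f h" and "a \<le> b"
  shows "energy a b (\<lambda>x. g x - h x) = 0"
proof -
  define d where "d = (\<lambda>x. g x - h x)"
  have d0: "has_L2_deriv a b (\<lambda>x. 0) d"
    using has_L2_deriv_diff[OF D1 D2] by (simp add: d_def)
  then have d: "sq_integrable a b d" by (rule has_L2_derivD)
  have "(energy a b d)\<^sup>2 \<le> energy a b d * e" if "e > 0" for e
  proof -
    obtain p where p: "real_polynomial_function p" "energy a b (\<lambda>x. d x - p x) < e"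
      using polynomials_dense_L2[OF d \<open>e > 0\<close> \<open>a \<le> b\<close>] .
    obtain p' where p': "real_polynomial_function p'" "\<And>x. (p has_real_derivative p' x) (at x)"
      using has_real_derivative_polynomial_function[OF p(1)] by blast
    have "continuous_on {a..b} p'"
      using p'(1) by (intro continuous_on_polymonial_function) (simp add: real_polynomial_function_eq)
    then have Dp: "has_L2_deriv a b p p'"
      by (intro has_L2_deriv_C1) (auto intro: has_field_derivative_at_within p')
    have sp: "sq_integrable a b p" by (intro sq_integrable_continuous has_L2_deriv_continuous[OF Dp])
    have "integral {a..b} (\<lambda>x. d x * p x) = 0"
      using integral_by_parts_L2_deriv[OF d0 Dp \<open>a \<le> b\<close>] by simp
    then have "energy a b d = integral {a..b} (\<lambda>x. d x * d x) - integral {a..b} (\<lambda>x. d x * p x)"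
      by (simp add: energy_def power2_eq_square)
    also have "\<dots> = integral {a..b} (\<lambda>x. d x * d x - d x * p x)"
      by (intro integral_diff[symmetric] sq_integrable_mult_integrable d sp)
    also have "\<dots> = integral {a..b} (\<lambda>x. d x * (d x - p x))" by (simp add: algebra_simps)
    finally have "(energy a b d)\<^sup>2 \<le> energy a b d * energy a b (\<lambda>x. d x - p x)"
      using Cauchy_Schwarz_integral[OF d sq_integrable_diff[OF d sp]] by simp
    also have "\<dots> \<le> energy a b d * e" using p(2) by (intro mult_left_mono) auto
    finally show ?thesis .
  qed
  from this[of "energy a b d / 2"] have "energy a b d \<le> 0"
    using energy_nonneg[of a b d] by (cases "energy a b d = 0") (auto simp: power2_eq_square)
  then show ?thesis unfolding d_def by (rule antisym) simp
qed

section \<open>Smooth bumps and the lemma of du Bois-Reymond\<close>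

text \<open>
  The functions \<open>p(x) y\<^sup>k exp(-y)\<close> with \<open>y = 1 / (x (1 - x))\<close>, extended by zero, form a family closed under
  differentiation: since \<open>y' = -(1 - 2 x) y\<^sup>2\<close>, the derivative is again of this form, with \<open>k + 2\<close> in place of \<open>k\<close>.
  Closure under differentiation yields smoothness without computing any higher derivative.
\<close>

definition bump :: "real poly \<Rightarrow> nat \<Rightarrow> real \<Rightarrow> real" where
  "bump p k x = (if 0 < x \<and> x < 1
     then poly p x * inverse (x * (1 - x)) ^ k * exp (- inverse (x * (1 - x))) else 0)"

lemma power_le_exp:
  fixes y :: real
  assumes "y \<ge> 0" "n > 0"
  shows "y ^ n \<le> real n ^ n * exp y"
proof -
  have "y / n \<le> exp (y / n)" using exp_ge_add_one_self[of "y / n"] by linarith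
  then have "(y / n) ^ n \<le> exp (y / n) ^ n" using assms by (intro power_mono) auto
  also have "\<dots> = exp y" using assms by (simp add: exp_of_nat_mult[symmetric])
  finally show ?thesis using assms by (simp add: power_divide field_simps)
qed

lemma DERIV_zero_if_quadratic_bound:
  fixes f :: "real \<Rightarrow> real"
  assumes "\<And>x. \<bar>f x\<bar> \<le> C * (x - x0)\<^sup>2"
  shows "(f has_real_derivative 0) (at x0)"
  unfolding has_field_derivative_iff
proof (rule Lim_null_comparison)
  have "f x0 = 0" using assms[of x0] by simp
  show "\<forall>\<^sub>F x in at x0. norm ((f x - f x0) / (x - x0)) \<le> C * \<bar>x - x0\<bar>"
    unfolding eventually_at_filter
  proof (intro always_eventually allI impI)
    fix x assume "x \<noteq> x0"
    then show "norm ((f x - f x0) / (x - x0)) \<le> C * \<bar>x - x0\<bar>"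
      using assms[of x] \<open>f x0 = 0\<close> by (simp add: field_simps power2_eq_square flip: abs_mult)
  qed
  show "((\<lambda>x. C * \<bar>x - x0\<bar>) \<longlongrightarrow> 0) (at x0)" by (auto intro!: tendsto_eq_intros)
qed

text \<open>
  Since \<open>y\<^sup>k\<^sup>+\<^sup>2 exp(-y)\<close> is bounded, the bump is at most a constant times \<open>1 / y\<^sup>2 = (x (1 - x))\<^sup>2\<close>, and
  \<open>x (1 - x)\<close> does not exceed the distance from \<open>x\<close> to any point \<open>x0\<close> outside \<open>(0,1)\<close>. One bound thus
  covers the two end points, where smoothness is at stake, and the outside of the interval.
\<close>

lemma bump_quadratic_bound:
  assumes "\<not> (0 < x0 \<and> x0 < 1)"
  shows "\<exists>C. \<forall>x. \<bar>bump p k x\<bar> \<le> C * (x - x0)\<^sup>2"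
proof -
  obtain K where K: "\<And>x. x \<in> {0..1} \<Longrightarrow> \<bar>poly p x\<bar> \<le> K"
  proof -
    have "compact (poly p ` {0..1})"
      by (intro compact_continuous_image) (auto intro!: continuous_intros)
    then obtain K where "\<forall>y\<in>poly p ` {0..1}. norm y \<le> K"
      using compact_imp_bounded bounded_iff by metis
    then show ?thesis by (intro that[of K]) simp
  qed
  have "\<bar>poly p 0\<bar> \<le> K" by (rule K) simp
  then have K0: "K \<ge> 0" by linarith
  define L where "L = real (k + 2) ^ (k + 2)"
  have "\<bar>bump p k x\<bar> \<le> (K * L) * (x - x0)\<^sup>2" for x
  proof (cases "0 < x \<and> x < 1")
    case True
    define m where "m = x * (1 - x)"
    have m: "m > 0" using True by (simp add: m_def)
    have "x * (1 - x) \<le> x" "x * (1 - x) \<le> 1 - x" 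
      using True by (simp_all add: mult_left_le mult_left_le_one_le)
    then have mx: "m \<le> \<bar>x - x0\<bar>" unfolding m_def using assms True by linarith
    have "inverse m ^ (k + 2) * exp (- inverse m) \<le> L"
    proof -
      have "inverse m ^ (k + 2) * exp (- inverse m) \<le> L * exp (inverse m) * exp (- inverse m)"
        unfolding L_def using m by (intro mult_right_mono power_le_exp) simp_all
      then show ?thesis by (simp only: mult.assoc exp_minus_inverse mult_1_right)
    qed
    then have "m\<^sup>2 * (inverse m ^ (k + 2) * exp (- inverse m)) \<le> m\<^sup>2 * L"
      by (intro mult_left_mono) auto
    also have "m\<^sup>2 * (inverse m ^ (k + 2) * exp (- inverse m)) = inverse m ^ k * exp (- inverse m)"
    proof -
      have "m\<^sup>2 * (inverse m)\<^sup>2 = 1" using m by (simp add: power_mult_distrib[symmetric])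
      moreover have "m\<^sup>2 * (inverse m ^ (k + 2) * exp (- inverse m))
          = (m\<^sup>2 * (inverse m)\<^sup>2) * (inverse m ^ k * exp (- inverse m))"
        by (simp only: power_add mult_ac)
      ultimately show ?thesis by simp
    qed
    also have "m\<^sup>2 * L \<le> (x - x0)\<^sup>2 * L"
      using mx m abs_le_square_iff[of m "x - x0"] by (intro mult_right_mono) (simp_all add: L_def)
    finally have "\<bar>poly p x\<bar> * (inverse m ^ k * exp (- inverse m)) \<le> K * ((x - x0)\<^sup>2 * L)"
      by (rule mult_mono[rotated]) (use K[of x] True K0 m in simp_all)
    moreover have "\<bar>bump p k x\<bar> = \<bar>poly p x\<bar> * (inverse m ^ k * exp (- inverse m))"
      using True m by (simp add: bump_def abs_mult flip: m_def)
    ultimately show ?thesis by (simp only: mult_ac)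
  next
    case False
    then have "bump p k x = 0" by (auto simp: bump_def)
    then show ?thesis using K0 by (simp add: L_def)
  qed
  then show ?thesis by blast
qed

definition bump_deriv :: "real poly \<Rightarrow> nat \<Rightarrow> real poly" where
  "bump_deriv p k = pderiv p * [:0, 1, -1:]\<^sup>2 - smult (real k) (p * [:0, 1, -1:] * [:1, -2:]) + p * [:1, -2:]"

lemma bump_has_derivative:
  "(bump p k has_real_derivative bump (bump_deriv p k) (k + 2) x) (at x)"
proof (cases "0 < x \<and> x < 1")
  case True
  define m where "m = (\<lambda>x :: real. x * (1 - x))"
  have m: "m x \<noteq> 0" using True by (simp add: m_def)
  have dm: "(m has_real_derivative (1 - 2 * x)) (at x)"
    unfolding m_def by (auto intro!: derivative_eq_intros)
  have "((\<lambda>x. poly p x * inverse (m x) ^ k * exp (- inverse (m x))) has_real_derivative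
      (poly (pderiv p) x * inverse (m x) ^ k - poly p x * (real k * inverse (m x) ^ (k + 1) * (1 - 2 * x))
       + poly p x * inverse (m x) ^ (k + 2) * (1 - 2 * x)) * exp (- inverse (m x))) (at x)"
    by (rule derivative_eq_intros dm poly_DERIV m refl | simp)+
      (use m in \<open>cases k; simp add: field_simps power2_eq_square\<close>)
  also have "(poly (pderiv p) x * inverse (m x) ^ k - poly p x * (real k * inverse (m x) ^ (k + 1) * (1 - 2 * x))
       + poly p x * inverse (m x) ^ (k + 2) * (1 - 2 * x)) =
      (poly (pderiv p) x * (m x)\<^sup>2 - real k * (poly p x * m x * (1 - 2 * x)) + poly p x * (1 - 2 * x)) * inverse (m x) ^ (k + 2)"
    using m by (simp add: field_simps power2_eq_square)
  also have "(poly (pderiv p) x * (m x)\<^sup>2 - real k * (poly p x * m x * (1 - 2 * x)) + poly p x * (1 - 2 * x))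
     = poly (bump_deriv p k) x"
    by (simp add: bump_deriv_def m_def algebra_simps)
  finally have "((\<lambda>x. poly p x * inverse (m x) ^ k * exp (- inverse (m x))) has_real_derivative
      bump (bump_deriv p k) (k + 2) x) (at x)"
    using True by (simp add: bump_def m_def)
  then show ?thesis
    by (rule has_field_derivative_transform_within_open[of _ _ _ "{0<..<1}"])
      (use True in \<open>auto simp: bump_def m_def\<close>)
next
  case False
  obtain C where "\<And>y. \<bar>bump p k y\<bar> \<le> C * (y - x)\<^sup>2" using bump_quadratic_bound[OF False] by blast
  then have "(bump p k has_real_derivative 0) (at x)" by (rule DERIV_zero_if_quadratic_bound)
  then show ?thesis using False by (auto simp: bump_def)
qed

lemma bump_smult: "bump (smult r p) k x = r * bump p k x"
  by (simp add: bump_def)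

lemma bump_continuous: "continuous_on A (bump p k)"
  by (rule continuous_at_imp_continuous_on) (use bump_has_derivative DERIV_isCont in blast)

text \<open>
  The step is the normalised antiderivative of the basic bump \<open>exp (- 1 / (x (1 - x)))\<close>.
\<close>

lemma smooth_step_exists:
  obtains c s where "c > 0" "\<And>x. (s has_real_derivative bump [:c:] 0 x) (at x)"
    "\<And>x. x \<le> 0 \<Longrightarrow> s x = 0" "\<And>x. x \<ge> 1 \<Longrightarrow> s x = 1" "\<And>x. 0 \<le> s x \<and> s x \<le> (1 :: real)"
proof -
  have "\<exists>F. \<forall>x. -\<infinity> < ereal x \<longrightarrow> ereal x < \<infinity> \<longrightarrow> (F has_vector_derivative bump [:1:] 0 x) (at x)"
    by (rule einterval_antiderivative) (simp, rule DERIV_isCont[OF bump_has_derivative])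
  then obtain S where "\<And>x. (S has_vector_derivative bump [:1:] 0 x) (at x)" by auto
  then have S: "(S has_real_derivative bump [:1:] 0 x) (at x)" for x
    by (simp add: has_real_derivative_iff_has_vector_derivative)
  have contS: "continuous_on A S" for A
    by (rule continuous_at_imp_continuous_on) (use S DERIV_isCont in blast)
  have "S 0 < S 1"
    by (rule DERIV_pos_imp_increasing_open) (use S contS in \<open>auto simp: bump_def intro!: exI\<close>)
  define c where "c = 1 / (S 1 - S 0)"
  define s where "s = (\<lambda>x. c * (S x - S 0))"
  have c: "c > 0" using \<open>S 0 < S 1\<close> by (simp add: c_def)
  have bump_c: "bump [:c:] 0 x = c * bump [:1:] 0 x" for x by (simp add: bump_def)
  have s: "(s has_real_derivative bump [:c:] 0 x) (at x)" for x
  proof -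
    have "((\<lambda>x. c * (S x - S 0)) has_real_derivative c * (bump [:1:] 0 x - 0)) (at x)"
      by (intro DERIV_cmult DERIV_diff S DERIV_const)
    then show ?thesis by (simp add: s_def bump_c)
  qed
  have bump_nonneg: "bump [:c:] 0 x \<ge> 0" for x using c by (simp add: bump_def)
  have mono: "s x \<le> s y" if "x \<le> y" for x y
    by (rule DERIV_nonneg_imp_nondecreasing[OF that]) (use s bump_nonneg in blast)
  have conts: "continuous_on A s" for A
    by (rule continuous_at_imp_continuous_on) (use s DERIV_isCont in blast)
  have s01: "s 0 = 0" "s 1 = 1" using \<open>S 0 < S 1\<close> by (auto simp: s_def c_def)
  have const: "s y = s x" if "x \<le> y" and zero: "\<And>z. x < z \<Longrightarrow> z < y \<Longrightarrow> bump [:c:] 0 z = 0" for x y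
  proof (cases "x = y")
    case False
    then have "x < y" using that(1) by simp
    moreover have "(s has_real_derivative 0) (at z)" if "x < z" "z < y" for z
      using s[of z] zero[OF that] by simp
    ultimately show ?thesis using conts by (intro DERIV_isconst_end) auto
  qed simp
  show ?thesis
  proof (rule that[OF c s])
    show s0: "s x = 0" if "x \<le> 0" for x using const[of x 0] that s01 by (auto simp: bump_def)
    show s1: "s x = 1" if "x \<ge> 1" for x using const[of 1 x] that s01 by (auto simp: bump_def)
    show "0 \<le> s x \<and> s x \<le> 1" for x
      using mono[of 0 x] mono[of x 1] s0[of x] s1[of x] s01 by (cases "x \<le> 0"; cases "x \<ge> 1") auto
  qed
qed

lemma iterated_deriv_differentiable:
  fixes f :: "real \<Rightarrow> real"
  assumes "f \<in> F" and closed: "\<And>h. h \<in> F \<Longrightarrow> \<exists>h'\<in>F. \<forall>x. (h has_real_derivative h' x) (at x)"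
  shows "(deriv ^^ n) f field_differentiable at x"
proof -
  have "(deriv ^^ n) f \<in> F"
  proof (induction n)
    case (Suc n)
    then obtain h' where h': "h' \<in> F" "\<And>x. ((deriv ^^ n) f has_real_derivative h' x) (at x)"
      using closed by blast
    then have "deriv ((deriv ^^ n) f) = h'" using DERIV_imp_deriv by blast
    then show ?case using h'(1) by simp
  qed (simp add: \<open>f \<in> F\<close>)
  then show ?thesis using closed field_differentiable_def by blast
qed

text \<open>
  The lemma of du Bois-Reymond. For \<open>0 < a \<le> b < 1\<close> the difference of two rescaled smooth steps, one rising at \<open>a\<close>
  and one rising at \<open>b\<close>, is a test function close to the indicator of \<open>[a,b]\<close>. Its derivative is the
  difference of two approximate identities, so the weak formulation tends to
  \<open>f a - f b = - \<integral>\<^sub>a\<^sup>b g\<close>. Continuity of \<open>f\<close> carries the identity to the end points.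
\<close>

lemma weak_imp_has_L2_deriv:
  assumes weak: "has_weak_derivative f g" and cont: "continuous_on {0..1} f"
  shows "has_L2_deriv 0 1 f g"
proof -
  obtain c s where "c > 0" and s: "\<And>x. (s has_real_derivative bump [:c:] 0 x) (at x)"
    and s0: "\<And>x. x \<le> 0 \<Longrightarrow> s x = 0" and s1: "\<And>x. x \<ge> 1 \<Longrightarrow> s x = 1"
    and s_bounds: "\<And>x. 0 \<le> s x \<and> s x \<le> (1 :: real)"
    using smooth_step_exists by blast
  define bet where "bet = bump [:c:] 0"
  have bet_nonneg: "bet x \<ge> 0" for x using \<open>c > 0\<close> by (simp add: bet_def bump_def)
  define K where "K a e x = bet ((x - a) / e) / e" for a e x :: real
  have step_deriv: "((\<lambda>x. s ((x - a) / e)) has_real_derivative K a e x) (at x)" if "e > 0" for a e x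
  proof -
    have "((\<lambda>x. (x - a) / e) has_real_derivative 1 / e) (at x)"
      using that by (auto intro!: derivative_eq_intros)
    from DERIV_chain2[OF s this] show ?thesis by (simp add: K_def bet_def)
  qed
  have K_cont: "continuous_on A (K a e)" if "e > 0" for A a e
    unfolding K_def bet_def using that
    by (intro continuous_intros continuous_on_compose2[OF bump_continuous[of UNIV]]) auto
  have g: "sq_integrable 0 1 g" and f: "sq_integrable 0 1 f"
    using weak by (auto simp: has_weak_derivative_def L2_iff_sq_integrable)
  have test: "test_function (\<lambda>x. s ((x - a) / e) - s ((x - b) / e))"
    if e: "e > 0" and "0 < a" "a \<le> b" "b + e < 1" for a b e
    unfolding test_function_def
  proof (intro conjI allI)
    let ?\<phi> = "\<lambda>x. s ((x - a) / e) - s ((x - b) / e)"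
    let ?h = "\<lambda>p k x. bump p k ((x - a) / e) - bump p k ((x - b) / e)"
    have h: "(?h p k has_real_derivative ?h (smult (1 / e) (bump_deriv p k)) (k + 2) x) (at x)" for p k x
    proof -
      have d: "((\<lambda>x. (x - r) / e) has_real_derivative 1 / e) (at x)" for r
        using e by (auto intro!: derivative_eq_intros)
      show ?thesis
        by (rule DERIV_cong[OF DERIV_diff[OF DERIV_chain2[OF bump_has_derivative d]
              DERIV_chain2[OF bump_has_derivative d]]]) (simp add: bump_smult)
    qed
    have "(?\<phi> has_real_derivative ?h (smult (1 / e) [:c:]) 0 x) (at x)" for x
      by (rule DERIV_cong[OF DERIV_diff[OF step_deriv step_deriv]]) (use e in \<open>auto simp: K_def bet_def bump_def\<close>)
    note \<phi> = this
    show "(deriv ^^ n) ?\<phi> field_differentiable at x" for n x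
    proof (rule iterated_deriv_differentiable[of _ "insert ?\<phi> {?h p k | p k. True}"])
      fix g assume "g \<in> insert ?\<phi> {?h p k | p k. True}"
      then consider "g = ?\<phi>" | p k where "g = ?h p k" by blast
      then show "\<exists>g'\<in>insert ?\<phi> {?h p k | p k. True}. \<forall>x. (g has_real_derivative g' x) (at x)"
      proof cases
        case 1
        show ?thesis unfolding 1 using \<phi> by (intro bexI[of _ "?h (smult (1 / e) [:c:]) 0"]) blast+
      next
        case 2
        show ?thesis unfolding 2 using h
          by (intro bexI[of _ "?h (smult (1 / e) (bump_deriv p k)) (k + 2)"]) blast+
      qed
    qed simp
    have "?\<phi> x = 0" if "x \<notin> {a..b + e}" for x
    proof (cases "x < a")
      case True
      then have "(x - a) / e \<le> 0" "(x - b) / e \<le> 0"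
        using e \<open>a \<le> b\<close> by (auto simp: divide_nonpos_pos)
      then show ?thesis using s0 by simp
    next
      case False
      then have "(x - a) / e \<ge> 1" "(x - b) / e \<ge> 1"
        using e \<open>a \<le> b\<close> that by (auto simp: field_simps)
      then show ?thesis using s1 by simp
    qed
    then have "{x. ?\<phi> x \<noteq> 0} \<subseteq> {a..b + e}" by blast
    then have sub: "closure {x. ?\<phi> x \<noteq> 0} \<subseteq> {a..b + e}" by (rule closure_minimal) simp
    show "compact (closure {x. ?\<phi> x \<noteq> 0})"
      using sub by (meson bounded_closed_interval bounded_subset closed_closure compact_eq_bounded_closed)
    show "closure {x. ?\<phi> x \<noteq> 0} \<subseteq> {0<..<1}" using sub that by force
  qed
  have approx_identity: "(\<lambda>n. integral {0..1} (\<lambda>x. f x * K a (e n) x)) \<longlonglongrightarrow> f a"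
    if e: "\<And>n. e n > 0" "e \<longlonglongrightarrow> 0" and a: "0 < a" "a < 1" for e a
  proof (rule LIMSEQ_I)
    fix r :: real assume "r > 0"
    then obtain d where d: "d > 0" "\<And>x. x \<in> {0..1} \<Longrightarrow> dist x a < d \<Longrightarrow> dist (f x) (f a) < r / 2"
      using cont a unfolding continuous_on_iff by (metis atLeastAtMost_iff half_gt_zero less_imp_le)
    have "\<forall>\<^sub>F n in sequentially. e n < min d (1 - a)" using d(1) a by (intro order_tendstoD[OF e(2)]) auto
    then obtain n0 where n0: "\<And>n. n \<ge> n0 \<Longrightarrow> e n < min d (1 - a)"
      by (auto simp: eventually_sequentially)
    show "\<exists>n0. \<forall>n\<ge>n0. norm (integral {0..1} (\<lambda>x. f x * K a (e n) x) - f a) < r"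
    proof (intro exI[of _ n0] allI impI)
      fix n assume "n0 \<le> n"
      note en = n0[OF this] and e0 = e(1)[of n]
      \<comment> \<open>The kernel has mass one as soon as the transition interval \<open>[a, a + e n]\<close> lies inside \<open>[0,1]\<close>.\<close>
      have "(K a (e n) has_integral s ((1 - a) / e n) - s ((0 - a) / e n)) {0..1}"
        by (rule fundamental_theorem_of_calculus)
          (auto simp flip: has_real_derivative_iff_has_vector_derivative
            intro: has_field_derivative_at_within step_deriv[OF e0])
      moreover have "s ((1 - a) / e n) = 1" using en e0 a by (intro s1) (auto simp: field_simps)
      moreover have "s ((0 - a) / e n) = 0" using e0 a by (intro s0) (auto simp: field_simps)
      ultimately have K1: "integral {0..1} (K a (e n)) = 1" and Ki: "K a (e n) integrable_on {0..1}"
        by (auto simp: has_integral_iff)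
      have fK: "(\<lambda>x. f x * K a (e n) x) integrable_on {0..1}"
        by (intro sq_integrable_mult_integrable f sq_integrable_continuous K_cont[OF e0])
      have "integral {0..1} (\<lambda>x. f x * K a (e n) x) - f a
          = integral {0..1} (\<lambda>x. f x * K a (e n) x - f a * K a (e n) x)"
        using K1 by (simp add: integral_diff[OF fK integrable_on_mult_right[OF Ki]])
      also have "norm \<dots> \<le> integral {0..1} (\<lambda>x. r / 2 * K a (e n) x)"
      proof (rule integral_norm_bound_integral)
        show "(\<lambda>x. f x * K a (e n) x - f a * K a (e n) x) integrable_on {0..1}"
          by (intro integrable_diff fK integrable_on_mult_right[OF Ki])
        show "(\<lambda>x. r / 2 * K a (e n) x) integrable_on {0..1}" by (rule integrable_on_mult_right[OF Ki])
        fix x :: real assume x: "x \<in> {0..1}"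
        have K0: "K a (e n) x \<ge> 0" using bet_nonneg e0 by (simp add: K_def)
        show "norm (f x * K a (e n) x - f a * K a (e n) x) \<le> r / 2 * K a (e n) x"
        proof (cases "K a (e n) x = 0")
          case False
          then have "0 < (x - a) / e n" "(x - a) / e n < 1"
            by (auto simp: K_def bet_def bump_def split: if_splits)
          then have "dist x a < d" using en e0 by (auto simp: dist_real_def field_simps)
          then have "\<bar>f x - f a\<bar> \<le> r / 2" using d(2)[OF x] by (simp add: dist_real_def)
          then have "\<bar>f x - f a\<bar> * K a (e n) x \<le> r / 2 * K a (e n) x" using K0 by (rule mult_right_mono)
          then show ?thesis using K0 by (simp add: abs_mult flip: left_diff_distrib)
        qed simp
      qed
      also have "\<dots> = r / 2" using K1 by simp
      finally show "norm (integral {0..1} (\<lambda>x. f x * K a (e n) x) - f a) < r" using \<open>r > 0\<close> by simp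
    qed
  qed
  have interior: "f b - f a = integral {a..b} g" if ab: "0 < a" "a \<le> b" "b < 1" for a b
  proof -
    \<comment> \<open>Widths small enough that the second step is completed before \<open>1\<close>.\<close>
    define e where "e n = (1 - b) * inverse (real (Suc (Suc n)))" for n
    have e0: "e n > 0" for n using ab by (simp add: e_def)
    have eb: "b + e n < 1" for n
    proof -
      have "(1 - b) * inverse (real (Suc (Suc n))) < (1 - b) * 1"
        using ab by (intro mult_strict_left_mono) (auto simp: field_simps)
      then show ?thesis by (simp add: e_def)
    qed
    have lim_e: "e \<longlonglongrightarrow> 0"
      unfolding e_def by (rule tendsto_mult_right_zero[OF LIMSEQ_Suc[OF LIMSEQ_inverse_real_of_nat]])
    define \<phi> where "\<phi> n x = s ((x - a) / e n) - s ((x - b) / e n)" for n x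
    have \<phi>: "test_function (\<phi> n)" for n unfolding \<phi>_def using e0 ab eb by (intro test)
    have d\<phi>: "deriv (\<phi> n) = (\<lambda>x. K a (e n) x - K b (e n) x)" for n
      unfolding \<phi>_def by (rule ext, rule DERIV_imp_deriv, intro DERIV_diff step_deriv e0)
    have s\<phi>: "sq_integrable 0 1 (\<phi> n)" for n
      using test_function_has_L2_deriv[OF \<phi>] has_L2_deriv_continuous sq_integrable_continuous by blast
    have sK: "sq_integrable 0 1 (K x (e n))" for n x
      by (intro sq_integrable_continuous K_cont e0)
    have "integral {0..1} (\<lambda>x. f x * K b (e n) x) - integral {0..1} (\<lambda>x. f x * K a (e n) x)
         = integral {0..1} (\<lambda>x. g x * \<phi> n x)" for n
    proof -
      have "(\<integral>x. f x * deriv (\<phi> n) x \<partial>lebesgue_on {0..1}) = - (\<integral>x. g x * \<phi> n x \<partial>lebesgue_on {0..1})"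
        using weak \<phi> by (simp add: has_weak_derivative_def)
      moreover have "(\<integral>x. f x * deriv (\<phi> n) x \<partial>lebesgue_on {0..1}) = integral {0..1} (\<lambda>x. f x * deriv (\<phi> n) x)"
        unfolding d\<phi> by (intro lebesgue_integral_mult_eq f sq_integrable_diff sK)
      moreover have "\<dots> = integral {0..1} (\<lambda>x. f x * K a (e n) x) - integral {0..1} (\<lambda>x. f x * K b (e n) x)"
        unfolding d\<phi> right_diff_distrib by (intro integral_diff sq_integrable_mult_integrable f sK)
      ultimately show ?thesis using lebesgue_integral_mult_eq[OF g s\<phi>] by simp
    qed
    then have "(\<lambda>n. integral {0..1} (\<lambda>x. g x * \<phi> n x)) \<longlonglongrightarrow> f b - f a"
      using tendsto_diff[OF approx_identity[OF e0 lim_e, of b] approx_identity[OF e0 lim_e, of a]] ab by simp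
    moreover have "(\<lambda>n. integral {0..1} (\<lambda>x. g x * \<phi> n x)) \<longlonglongrightarrow> integral {0..1} (\<lambda>x. if x \<in> {a<..b} then g x else 0)"
    proof (rule dominated_convergence(2))
      show "(\<lambda>x. g x * \<phi> n x) integrable_on {0..1}" for n by (intro sq_integrable_mult_integrable g s\<phi>)
      show "(\<lambda>x. \<bar>g x\<bar>) integrable_on {0..1}" by (rule sq_integrable_abs_integrable[OF g])
      show "norm (g x * \<phi> n x) \<le> \<bar>g x\<bar>" for n x
      proof -
        have "\<bar>\<phi> n x\<bar> \<le> 1" using s_bounds[of "(x - a) / e n"] s_bounds[of "(x - b) / e n"] by (auto simp: \<phi>_def)
        then show ?thesis by (simp add: abs_mult mult_left_le)
      qed
      \<comment> \<open>The limit is the indicator of the half-open interval, since the steps rise to the right of \<open>a\<close> and \<open>b\<close>.\<close>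
    have step: "(\<lambda>n. s ((x - y) / e n)) \<longlonglongrightarrow> (if x \<le> y then 0 else 1)" for x y
      proof (cases "x \<le> y")
        case True
        then have "s ((x - y) / e n) = 0" for n using e0[of n] by (intro s0) (auto simp: field_simps)
        then show ?thesis using True by simp
      next
        case False
        then have "\<forall>\<^sub>F n in sequentially. e n < x - y" by (intro order_tendstoD[OF lim_e]) auto
        then have "\<forall>\<^sub>F n in sequentially. s ((x - y) / e n) = 1"
          by eventually_elim (use e0 in \<open>auto intro!: s1 simp: field_simps\<close>)
        then show ?thesis using False by (simp add: tendsto_eventually)
      qed
      show "(\<lambda>n. g x * \<phi> n x) \<longlonglongrightarrow> (if x \<in> {a<..b} then g x else 0)" for x
        using tendsto_mult[OF tendsto_const[of "g x"] tendsto_diff[OF step[of x a] step[of x b]]] ab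
        unfolding \<phi>_def by (auto split: if_splits)
    qed
    ultimately have "f b - f a = integral {0..1} (\<lambda>x. if x \<in> {a<..b} then g x else 0)"
      by (rule LIMSEQ_unique)
    also have "\<dots> = integral {0..1} (\<lambda>x. if x \<in> {a..b} then g x else 0)"
      by (rule integral_spike[of "{a}"]) auto
    also have "\<dots> = integral {a..b} g"
      using ab by (subst integral_restrict_Int) (simp add: Int_absorb1 Int_absorb2)
    finally show ?thesis .
  qed
  define G where "G x = f x - integral {0..x} g" for x
  have gi: "g integrable_on {0..1}" using g by (rule sq_integrableD)
  have G_cont: "continuous_on {0..1} G"
    unfolding G_def by (intro continuous_intros cont indefinite_integral_continuous_1 gi)
  have split: "integral {0..x} g + integral {x..y} g = integral {0..y} g"
    if "0 \<le> x" "x \<le> y" "y \<le> 1" for x y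
    using that integrable_on_subinterval[OF gi, of 0 y]
    by (intro Henstock_Kurzweil_Integration.integral_combine) auto
  have G_int: "G y = G x" if "0 < x" "x \<le> y" "y < 1" for x y
    using interior[OF that] split[of x y] that unfolding G_def by linarith
  have G_const: "G x = G (1/2)" if "x \<in> {0..1}" for x
  proof (rule continuous_constant_on_closure[of "{0<..<1}" G])
    show "G x = G (1/2)" if "x \<in> {0<..<1}" for x
      using G_int[of x "1/2"] G_int[of "1/2" x] that by (cases "x \<le> 1/2") auto
  qed (use G_cont that in auto)
  show ?thesis
    unfolding has_L2_deriv_def
  proof (intro conjI allI impI g)
    fix x y :: real assume xy: "0 \<le> x" "x \<le> y" "y \<le> 1"
    then show "f y - f x = integral {x..y} g"
      using G_const[of x] G_const[of y] split[OF xy] unfolding G_def atLeastAtMost_iff by linarith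
  qed
qed

section \<open>Translations and difference quotients in the mean square sense\<close>

lemma ex_antiderivative:
  fixes f :: "real \<Rightarrow> real"
  assumes "\<And>x. isCont f x"
  obtains F where "\<And>x. (F has_real_derivative f x) (at x)"
proof -
  have "\<exists>F. \<forall>x. -\<infinity> < ereal x \<longrightarrow> ereal x < \<infinity> \<longrightarrow> (F has_vector_derivative f x) (at x)"
    by (rule einterval_antiderivative) (simp, rule assms)
  then show ?thesis using that by (auto simp: has_real_derivative_iff_has_vector_derivative)
qed

lemma eventually_uniformly_close:
  fixes F :: "real \<Rightarrow> real \<Rightarrow> real"
  assumes "continuous_on (T \<times> {a..b}) (\<lambda>z. F (fst z) (snd z))" "t \<in> T" "e > 0"
  shows "\<forall>\<^sub>F s in at t within T. \<forall>x\<in>{a..b}. \<bar>F s x - F t x\<bar> \<le> e"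
proof -
  obtain X0 where "t \<in> X0" "open X0" and X0: "\<forall>s\<in>X0 \<inter> T. \<forall>x\<in>{a..b}. dist (F s x) (F t x) \<le> e"
    using continuous_on_prod_compactE[OF assms(1) compact_Icc assms(2,3)] by auto
  then show ?thesis unfolding eventually_at_topological by (auto simp: dist_real_def)
qed

lemma tendsto_0_if_eventually_le:
  fixes f :: "'a \<Rightarrow> real"
  assumes "\<And>s. f s \<ge> 0" "\<And>e. e > 0 \<Longrightarrow> \<forall>\<^sub>F s in F. f s \<le> e"
  shows "(f \<longlongrightarrow> 0) F"
proof (rule tendstoI)
  fix e :: real assume "e > 0"
  then have "\<forall>\<^sub>F s in F. f s \<le> e / 2" using assms(2)[of "e / 2"] by simp
  then show "\<forall>\<^sub>F s in F. dist (f s) 0 < e"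
    by eventually_elim (use assms(1) \<open>e > 0\<close> in \<open>simp add: dist_real_def\<close>)
qed

lemma energy_tendsto_0_if_uniform:
  assumes "\<And>s. s \<in> T \<Longrightarrow> sq_integrable 0 1 (f s)" "t \<in> T"
    and unif: "\<And>e. e > 0 \<Longrightarrow> \<forall>\<^sub>F s in at t within T. \<forall>x\<in>{0..1}. \<bar>f s x\<bar> \<le> e"
  shows "((\<lambda>s. energy 0 1 (f s)) \<longlongrightarrow> 0) (at t within T)"
proof (rule tendsto_0_if_eventually_le)
  fix e :: real assume "e > 0"
  then have "\<forall>\<^sub>F s in at t within T. \<forall>x\<in>{0..1}. \<bar>f s x\<bar> \<le> sqrt e" by (intro unif) simp
  moreover have "\<forall>\<^sub>F s in at t within T. s \<in> T" by (simp add: eventually_at_filter)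
  ultimately show "\<forall>\<^sub>F s in at t within T. energy 0 1 (f s) \<le> e"
  proof eventually_elim
    case (elim s)
    then have "energy 0 1 (f s) \<le> (sqrt e)\<^sup>2 * (1 - 0)"
      by (intro energy_le_const assms) auto
    then show ?case using \<open>e > 0\<close> by simp
  qed
qed simp

text \<open>
  A polynomial close to \<open>k\<close> on a neighbourhood of \<open>[0,1]\<close> is uniformly continuous there, and
  translation by a small \<open>h\<close> keeps its distance to \<open>k\<close> small.
\<close>

lemma translation_continuous_L2:
  assumes k: "sq_integrable (-1) 2 k"
  shows "((\<lambda>h. energy 0 1 (\<lambda>x. k (x + h) - k x)) \<longlongrightarrow> 0) (at 0)"
proof (rule tendsto_0_if_eventually_le)
  fix e :: real assume "e > 0"
  obtain p where "real_polynomial_function p" and p: "energy (-1) 2 (\<lambda>x. k x - p x) < e / 16"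
    using polynomials_dense_L2[OF k, of "e / 16"] \<open>e > 0\<close> by auto
  then have cp: "continuous_on A p" for A
    by (intro continuous_on_polymonial_function) (simp add: real_polynomial_function_eq)
  have kp: "sq_integrable (-1) 2 (\<lambda>x. k x - p x)" by (intro sq_integrable_diff k sq_integrable_continuous cp)
  have "continuous_on (UNIV \<times> {0..1}) (\<lambda>z :: real \<times> real. p (snd z + fst z))"
    by (intro continuous_on_compose2[OF cp[of UNIV]] continuous_intros) auto
  then have "\<forall>\<^sub>F h in at 0. \<forall>x\<in>{0..1}. \<bar>p (x + h) - p (x + 0)\<bar> \<le> sqrt (e / 16)"
    using eventually_uniformly_close[of UNIV 0 1 "\<lambda>h x. p (x + h)" 0 "sqrt (e / 16)"] \<open>e > 0\<close> by simp
  moreover have "\<forall>\<^sub>F h :: real in at 0. \<bar>h\<bar> < 1" by (auto simp: eventually_at dist_real_def intro: exI[of _ 1])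
  ultimately show "\<forall>\<^sub>F h in at 0. energy 0 1 (\<lambda>x. k (x + h) - k x) \<le> e"
  proof eventually_elim
    case (elim h)
    have sk: "sq_integrable 0 1 k" "sq_integrable 0 1 (\<lambda>x. k (x + h))"
      using elim by (auto simp: sq_integrable_shift intro: sq_integrable_subinterval[OF k])
    have sp: "sq_integrable 0 1 p" "sq_integrable 0 1 (\<lambda>x. p (x + h))"
      by (auto simp: sq_integrable_shift intro: sq_integrable_continuous cp)
    have "energy 0 1 (\<lambda>x. k (x + h) - p (x + h)) \<le> energy (-1) 2 (\<lambda>x. k x - p x)"
      using energy_shift[of 0 1 "\<lambda>x. k x - p x" h] elim by (simp add: energy_subinterval[OF kp])
    moreover have "energy 0 1 (\<lambda>x. p x - k x) \<le> energy (-1) 2 (\<lambda>x. k x - p x)"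
      using energy_subinterval[OF kp, of 0 1] by (simp add: energy_def power2_commute)
    moreover have "energy 0 1 (\<lambda>x. p (x + h) - p x) \<le> (sqrt (e / 16))\<^sup>2 * (1 - 0)"
      using elim by (intro energy_le_const sq_integrable_diff sp) auto
    moreover have "energy 0 1 (\<lambda>x. p (x + h) - k x)
        \<le> 2 * energy 0 1 (\<lambda>x. p (x + h) - p x) + 2 * energy 0 1 (\<lambda>x. p x - k x)"
      by (intro energy_diff_le sq_integrable_diff sp sk)
    moreover have "energy 0 1 (\<lambda>x. k (x + h) - k x)
        \<le> 2 * energy 0 1 (\<lambda>x. k (x + h) - p (x + h)) + 2 * energy 0 1 (\<lambda>x. p (x + h) - k x)"
      by (intro energy_diff_le sq_integrable_diff sp sk)
    ultimately show ?case using p \<open>e > 0\<close> by simp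
  qed
qed simp

text \<open>
  The Cauchy-Schwarz inequality on \<open>[x,x+h]\<close> bounds the squared quotient by \<open>(K (x + h) - K x) / h\<close>, where \<open>K\<close> is the
  indefinite integral of \<open>r\<^sup>2\<close>. Integrating over \<open>[c,d]\<close>, the two integrals of \<open>K\<close> cancel except for two
  end pieces of length \<open>h\<close>; this replaces an exchange of integrals.
\<close>

lemma difference_quotient_bound:
  assumes D: "has_L2_deriv c (d + h) R r" and h: "h > 0" and cd: "c \<le> d"
  shows "energy c d (\<lambda>x. (R (x + h) - R x) / h) \<le> energy c (d + h) r"
proof -
  define K where "K x = integral {c..x} (\<lambda>s. (r s)\<^sup>2)" for x
  note r = has_L2_derivD(1)[OF D]
  note r2 = sq_integrableD(2)[OF r]
  have K_cont: "continuous_on {c..d + h} K"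
    unfolding K_def by (rule indefinite_integral_continuous_1[OF r2])
  have Ki: "K integrable_on {x..y}" if "c \<le> x" "y \<le> d + h" for x y
    by (rule integrable_continuous_interval) (use that in \<open>auto intro: continuous_on_subset[OF K_cont]\<close>)
  have K_diff: "K y - K x = energy x y r" if "c \<le> x" "x \<le> y" "y \<le> d + h" for x y
    using Henstock_Kurzweil_Integration.integral_combine[of c x y "\<lambda>s. (r s)\<^sup>2"] that
      integrable_on_subinterval[OF r2, of c y]
    by (simp add: K_def energy_def)
  have K_bounds: "0 \<le> K x" "K x \<le> energy c (d + h) r" if "c \<le> x" "x \<le> d + h" for x
    using energy_nonneg[of c x r] energy_subinterval[OF r, of c x] that by (auto simp: K_def energy_def)
  have R_cont: "continuous_on {c..d + h} R" by (rule has_L2_deriv_continuous[OF D])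
  have q: "sq_integrable c d (\<lambda>x. (R (x + h) - R x) / h)"
    using h by (intro sq_integrable_continuous continuous_intros continuous_on_compose2[OF R_cont]
        continuous_on_subset[OF R_cont]) auto
  have Kh: "(\<lambda>x. K (x + h)) integrable_on {c..d}"
    using integrable_shift_real_ivl[OF Ki[of "c + h" "d + h"], of h] h by simp
  have "energy c d (\<lambda>x. (R (x + h) - R x) / h) \<le> integral {c..d} (\<lambda>x. (K (x + h) - K x) / h)"
    unfolding energy_def
  proof (rule integral_le)
    show "(\<lambda>x. ((R (x + h) - R x) / h)\<^sup>2) integrable_on {c..d}" using q by (rule sq_integrableD)
    show "(\<lambda>x. (K (x + h) - K x) / h) integrable_on {c..d}"
      using h by (intro integrable_on_divide integrable_diff Kh Ki) auto
    fix x assume x: "x \<in> {c..d}"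
    have "(R (x + h) - R x)\<^sup>2 = (integral {x..x + h} r)\<^sup>2"
      using has_L2_derivD(2)[OF D, of x "x + h"] x h by simp
    also have "\<dots> \<le> (x + h - x) * energy x (x + h) r"
      using x h by (intro integral_sq_le_energy sq_integrable_subinterval[OF r]) auto
    also have "energy x (x + h) r = K (x + h) - K x" using K_diff[of x "x + h"] x h by simp
    finally have "(R (x + h) - R x)\<^sup>2 \<le> h * (K (x + h) - K x)" by simp
    then have "(R (x + h) - R x)\<^sup>2 / h\<^sup>2 \<le> h * (K (x + h) - K x) / h\<^sup>2" by (rule divide_right_mono) simp
    then show "((R (x + h) - R x) / h)\<^sup>2 \<le> (K (x + h) - K x) / h"
      using h by (simp add: power_divide power2_eq_square)
  qed
  also have "\<dots> = (integral {c..d} (\<lambda>x. K (x + h)) - integral {c..d} K) / h"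
    using h by (simp add: integral_diff[OF Kh Ki])
  also have "integral {c..d} (\<lambda>x. K (x + h)) = integral {c + h..d + h} K"
    using integral_shift_real_ivl[of "c + h" h "d + h" K] by simp
  also have "integral {c + h..d + h} K - integral {c..d} K = integral {d..d + h} K - integral {c..c + h} K"
    using Henstock_Kurzweil_Integration.integral_combine[of c "c + h" "d + h" K]
      Henstock_Kurzweil_Integration.integral_combine[of c d "d + h" K] Ki[of c "d + h"] h cd by simp
  also have "\<dots> \<le> h * energy c (d + h) r"
  proof -
    have "integral {d..d + h} K \<le> integral {d..d + h} (\<lambda>x. energy c (d + h) r)"
      using K_bounds cd by (intro integral_le Ki) auto
    moreover have "integral {c..c + h} K \<ge> 0"
      using K_bounds cd by (intro integral_nonneg Ki) auto
    ultimately show ?thesis using h by simp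
  qed
  finally show ?thesis using h by (simp add: divide_right_mono field_simps)
qed

lemma difference_quotient_bound_two_sided:
  assumes D: "has_L2_deriv (-1) 2 R r" and h: "h \<noteq> 0" "\<bar>h\<bar> \<le> 1"
  shows "energy 0 1 (\<lambda>x. (R (x + h) - R x) / h) \<le> energy (-1) 2 r"
proof (cases "h > 0")
  case True
  have "energy 0 1 (\<lambda>x. (R (x + h) - R x) / h) \<le> energy 0 (1 + h) r"
    using True h by (intro difference_quotient_bound has_L2_deriv_subinterval[OF D]) auto
  also have "\<dots> \<le> energy (-1) 2 r"
    using h True by (intro energy_subinterval has_L2_derivD(1)[OF D]) auto
  finally show ?thesis .
next
  case False
  \<comment> \<open>A backward quotient is a forward quotient based at \<open>x - g\<close>.\<close>
  define g where "g = - h"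
  have g: "g > 0" "g \<le> 1" using False h by (auto simp: g_def)
  have "energy 0 1 (\<lambda>x. (R (x + h) - R x) / h) = energy 0 1 (\<lambda>x. (R (x - g + g) - R (x - g)) / g)"
    by (simp add: g_def minus_divide_left[symmetric] energy_def power2_commute power_divide)
  also have "\<dots> = energy (- g) (1 - g) (\<lambda>x. (R (x + g) - R x) / g)"
    using energy_shift[of 0 1 "\<lambda>x. (R (x + g) - R x) / g" "- g"] by simp
  also have "\<dots> \<le> energy (- g) (1 - g + g) r"
    using g by (intro difference_quotient_bound has_L2_deriv_subinterval[OF D]) auto
  also have "\<dots> \<le> energy (-1) 2 r"
    using g by (intro energy_subinterval has_L2_derivD(1)[OF D]) auto
  finally show ?thesis .
qed

text \<open>
  Split \<open>w\<close> into the antiderivative of a polynomial \<open>p\<close> close to \<open>k\<close> and a remainder. Quotients of the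
  antiderivative converge uniformly by the mean value theorem; those of the remainder stay small, uniformly in \<open>h\<close>, by
  \<open>difference_quotient_bound_two_sided\<close>.
\<close>

lemma difference_quotient_tendsto_L2:
  assumes D: "has_L2_deriv (-1) 2 w k"
  shows "((\<lambda>h. energy 0 1 (\<lambda>x. (w (x + h) - w x) / h - k x)) \<longlongrightarrow> 0) (at 0)"
proof (rule tendsto_0_if_eventually_le)
  fix e :: real assume "e > 0"
  note k = has_L2_derivD(1)[OF D]
  obtain p where "real_polynomial_function p" and p: "energy (-1) 2 (\<lambda>x. k x - p x) < e / 16"
    using polynomials_dense_L2[OF k, of "e / 16"] \<open>e > 0\<close> by auto
  then have cp: "continuous_on A p" for A
    by (intro continuous_on_polymonial_function) (simp add: real_polynomial_function_eq)
  then have "isCont p x" for x using continuous_on_eq_continuous_at[OF open_UNIV] by blast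
  then obtain P where P: "\<And>x. (P has_real_derivative p x) (at x)" using ex_antiderivative by blast
  have DP: "has_L2_deriv a b P p" for a b
    by (intro has_L2_deriv_C1 cp has_field_derivative_at_within[OF P])
  note DR = has_L2_deriv_diff[OF D DP]
  have "uniformly_continuous_on {-1..2} p" by (intro compact_uniformly_continuous cp) simp
  then obtain d where "d > 0" and d: "\<And>x y. x \<in> {-1..2} \<Longrightarrow> y \<in> {-1..2} \<Longrightarrow> dist y x < d \<Longrightarrow> dist (p y) (p x) < sqrt (e / 16)"
    unfolding uniformly_continuous_on_def using \<open>e > 0\<close> by (metis divide_pos_pos real_sqrt_gt_zero zero_less_numeral)
  have "\<forall>\<^sub>F h :: real in at 0. h \<noteq> 0 \<and> \<bar>h\<bar> < min 1 d"
    using \<open>d > 0\<close> by (auto simp: eventually_at dist_real_def intro!: exI[of _ "min 1 d"])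
  then show "\<forall>\<^sub>F h in at 0. energy 0 1 (\<lambda>x. (w (x + h) - w x) / h - k x) \<le> e"
  proof eventually_elim
    case (elim h)
    let ?q = "\<lambda>w x. (w (x + h) - w x) / h"
    have sk: "sq_integrable 0 1 k" by (auto intro: sq_integrable_subinterval[OF k])
    have sp: "sq_integrable 0 1 p" by (intro sq_integrable_continuous cp)
    have cw: "continuous_on {-1..2} w" by (rule has_L2_deriv_continuous[OF D])
    have sw: "sq_integrable 0 1 (?q w)"
      using elim by (intro sq_integrable_continuous continuous_intros continuous_on_compose2[OF cw]
          continuous_on_subset[OF cw]) auto
    have cP: "continuous_on UNIV P" using P DERIV_isCont by (intro continuous_at_imp_continuous_on) blast
    have sP: "sq_integrable 0 1 (?q P)"
      using elim by (intro sq_integrable_continuous continuous_intros continuous_on_compose2[OF cP]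
          continuous_on_subset[OF cP]) auto
    have "energy 0 1 (\<lambda>x. ?q w x - ?q P x) = energy 0 1 (?q (\<lambda>x. w x - P x))"
      by (rule arg_cong[where f = "energy 0 1"], rule ext) (simp add: diff_divide_distrib)
    also have "\<dots> \<le> energy (-1) 2 (\<lambda>x. k x - p x)"
      using elim by (intro difference_quotient_bound_two_sided DR) auto
    finally have 1: "energy 0 1 (\<lambda>x. ?q w x - ?q P x) \<le> energy (-1) 2 (\<lambda>x. k x - p x)" .
    have 2: "energy 0 1 (\<lambda>x. p x - k x) \<le> energy (-1) 2 (\<lambda>x. k x - p x)"
      using energy_subinterval[OF has_L2_derivD(1)[OF DR], of 0 1] by (simp add: energy_def power2_commute)
    have "\<bar>?q P x - p x\<bar> \<le> sqrt (e / 16)" if x: "x \<in> {0..1}" for x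
    proof -
      have "\<exists>z. \<bar>z - x\<bar> \<le> \<bar>h\<bar> \<and> ?q P x = p z"
      proof (cases "h > 0")
        case True
        then obtain z where "x < z" "z < x + h" "P (x + h) - P x = (x + h - x) * p z"
          using MVT2[of x "x + h" P p] P by auto
        then show ?thesis using True by (intro exI[of _ z]) auto
      next
        case False
        then have "x + h < x" using elim by auto
        then obtain z where "x + h < z" "z < x" "P x - P (x + h) = (x - (x + h)) * p z"
          using MVT2[of "x + h" x P p] P by auto
        then show ?thesis using False elim by (intro exI[of _ z]) (auto simp: field_simps)
      qed
      then obtain z where z: "\<bar>z - x\<bar> \<le> \<bar>h\<bar>" "?q P x = p z" by blast
      have "z \<in> {-1..2}" "x \<in> {-1..2}" "dist z x < d" using z elim x by (auto simp: dist_real_def)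
      then show ?thesis using d[of x z] z by (simp add: dist_real_def)
    qed
    then have "energy 0 1 (\<lambda>x. ?q P x - p x) \<le> (sqrt (e / 16))\<^sup>2 * (1 - 0)"
      by (intro energy_le_const sq_integrable_diff sp sP) auto
    then have 3: "energy 0 1 (\<lambda>x. ?q P x - p x) \<le> e / 16" using \<open>e > 0\<close> by simp
    have 4: "energy 0 1 (\<lambda>x. ?q P x - k x) \<le> 2 * energy 0 1 (\<lambda>x. ?q P x - p x) + 2 * energy 0 1 (\<lambda>x. p x - k x)"
      by (intro energy_diff_le sq_integrable_diff sp sk sP)
    have "energy 0 1 (\<lambda>x. ?q w x - k x) \<le> 2 * energy 0 1 (\<lambda>x. ?q w x - ?q P x) + 2 * energy 0 1 (\<lambda>x. ?q P x - k x)"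
      by (intro energy_diff_le sq_integrable_diff sw sk sP)
    then show ?case using p 1 2 3 4 \<open>e > 0\<close> by linarith
  qed
qed simp

section \<open>Curves in the Sobolev space and the Lebesgue space\<close>

lemma H1_imp_has_L2_deriv:
  assumes "f \<in> H1"
  shows "has_L2_deriv 0 1 f (weak_deriv f)"
  using assms someI_ex[of "has_weak_derivative f"]
  by (auto simp: H1_def weak_deriv_def intro: weak_imp_has_L2_deriv)

lemma has_L2_deriv_imp_H1:
  assumes "has_L2_deriv 0 1 f g"
  shows "f \<in> H1"
  using has_L2_deriv_imp_weak[OF assms] has_L2_deriv_continuous[OF assms]
  by (auto simp: H1_def has_weak_derivative_def)

text \<open>
  Lets any convenient derivative stand in for the unspecified representative \<open>weak_deriv f\<close>.
\<close>

lemma energy_weak_deriv_diff: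
  assumes "has_L2_deriv 0 1 f g"
  shows "energy 0 1 (\<lambda>x. weak_deriv f x - g x) = 0"
  by (rule has_L2_deriv_unique[OF H1_imp_has_L2_deriv[OF has_L2_deriv_imp_H1[OF assms]] assms]) simp

lemma C0_L2_I:
  assumes "\<And>t. t \<ge> 0 \<Longrightarrow> sq_integrable 0 1 (u t)"
    and "\<And>t. t \<ge> 0 \<Longrightarrow> ((\<lambda>s. energy 0 1 (\<lambda>x. u s x - u t x)) \<longlongrightarrow> 0) (at t within {0..})"
  shows "C0_L2 u"
  unfolding C0_L2_def L2_iff_sq_integrable
proof (intro conjI allI impI assms)
  fix t :: real assume t: "t \<ge> 0"
  have "\<forall>\<^sub>F s in at t within {0..}. sq_integrable 0 1 (\<lambda>x. u s x - u t x)"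
    using assms(1) t by (auto simp: eventually_at_filter intro!: always_eventually sq_integrable_diff)
  then show "((\<lambda>s. norm2 (\<lambda>x. u s x - u t x)) \<longlongrightarrow> 0) (at t within {0..})"
    using assms(2)[OF t] by (simp add: norm2_tendsto_0_iff)
qed

lemma C0_H1_I:
  assumes D: "\<And>t. t \<ge> 0 \<Longrightarrow> has_L2_deriv 0 1 (u t) (k t)"
    and u: "\<And>t. t \<ge> 0 \<Longrightarrow> ((\<lambda>s. energy 0 1 (\<lambda>x. u s x - u t x)) \<longlongrightarrow> 0) (at t within {0..})"
    and k: "\<And>t. t \<ge> 0 \<Longrightarrow> ((\<lambda>s. energy 0 1 (\<lambda>x. k s x - k t x)) \<longlongrightarrow> 0) (at t within {0..})"
  shows "C0_H1 u"
  unfolding C0_H1_def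
proof (intro conjI allI impI)
  fix t :: real assume t: "t \<ge> 0"
  show "u t \<in> H1" by (rule has_L2_deriv_imp_H1[OF D[OF t]])
  have ev: "\<forall>\<^sub>F s in at t within {0..}. s \<ge> 0" by (simp add: eventually_at_filter)
  have D': "has_L2_deriv 0 1 (\<lambda>x. u s x - u t x) (\<lambda>x. k s x - k t x)" if "s \<ge> 0" for s
    by (intro has_L2_deriv_diff D that t)
  let ?W = "\<lambda>s. weak_deriv (\<lambda>x. u s x - u t x)"
  have sW: "sq_integrable 0 1 (?W s)" if "s \<ge> 0" for s
    using H1_imp_has_L2_deriv[OF has_L2_deriv_imp_H1[OF D'[OF that]]] by (rule has_L2_derivD)
  have "((\<lambda>s. energy 0 1 (?W s)) \<longlongrightarrow> 0) (at t within {0..})"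
  proof (rule Lim_null_comparison)
    show "\<forall>\<^sub>F s in at t within {0..}. norm (energy 0 1 (?W s)) \<le> 2 * energy 0 1 (\<lambda>x. k s x - k t x)"
      using ev
    proof eventually_elim
      case (elim s)
      have "energy 0 1 (\<lambda>x. (?W s x - (k s x - k t x)) + (k s x - k t x))
          \<le> 2 * energy 0 1 (\<lambda>x. ?W s x - (k s x - k t x)) + 2 * energy 0 1 (\<lambda>x. k s x - k t x)"
        by (intro energy_add_le sq_integrable_diff[OF sW[OF elim]] has_L2_derivD(1)[OF D'[OF elim]])
      then show ?case using energy_weak_deriv_diff[OF D'[OF elim]] by simp
    qed
    show "((\<lambda>s. 2 * energy 0 1 (\<lambda>x. k s x - k t x)) \<longlongrightarrow> 0) (at t within {0..})"
      using tendsto_mult_right_zero[OF k[OF t]] .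
  qed
  then have W: "((\<lambda>s. norm2 (?W s)) \<longlongrightarrow> 0) (at t within {0..})"
    by (subst norm2_tendsto_0_iff) (use ev in \<open>auto elim!: eventually_mono intro: sW\<close>)
  have "\<forall>\<^sub>F s in at t within {0..}. sq_integrable 0 1 (\<lambda>x. u s x - u t x)"
    using ev by eventually_elim (intro sq_integrable_continuous has_L2_deriv_continuous[OF D'])
  then have "((\<lambda>s. norm2 (\<lambda>x. u s x - u t x)) \<longlongrightarrow> 0) (at t within {0..})"
    using u[OF t] by (simp add: norm2_tendsto_0_iff)
  then have "((\<lambda>s. sqrt ((norm2 (\<lambda>x. u s x - u t x))\<^sup>2 + (norm2 (?W s))\<^sup>2)) \<longlongrightarrow> sqrt (0\<^sup>2 + 0\<^sup>2)) (at t within {0..})"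
    by (intro tendsto_intros W)
  then show "((\<lambda>s. H1_norm (\<lambda>x. u s x - u t x)) \<longlongrightarrow> 0) (at t within {0..})"
    by (simp add: H1_norm_def)
qed

lemma has_L2_time_derivative_iff:
  "has_L2_time_derivative u d t \<longleftrightarrow> (\<forall>s\<ge>0. sq_integrable 0 1 (u s)) \<and> sq_integrable 0 1 d \<and>
     ((\<lambda>s. energy 0 1 (\<lambda>x. (u s x - u t x) / (s - t) - d x)) \<longlongrightarrow> 0) (at t within {0..})"
  if "t \<ge> 0"
proof -
  have "((\<lambda>s. norm2 (\<lambda>x. (u s x - u t x) / (s - t) - d x)) \<longlongrightarrow> 0) (at t within {0..}) \<longleftrightarrow>
     ((\<lambda>s. energy 0 1 (\<lambda>x. (u s x - u t x) / (s - t) - d x)) \<longlongrightarrow> 0) (at t within {0..})"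
    if u: "\<forall>s\<ge>0. sq_integrable 0 1 (u s)" and d: "sq_integrable 0 1 d"
  proof (rule norm2_tendsto_0_iff)
    have "sq_integrable 0 1 (\<lambda>x. (u s x - u t x) / (s - t) - d x)" if "s \<ge> 0" for s
      using sq_integrable_diff[OF sq_integrable_cmult[OF sq_integrable_diff, of 0 1 "u s" "u t" "inverse (s - t)"] d]
        u that \<open>t \<ge> 0\<close> by (simp add: divide_inverse mult.commute)
    then show "\<forall>\<^sub>F s in at t within {0..}. sq_integrable 0 1 (\<lambda>x. (u s x - u t x) / (s - t) - d x)"
      by (simp add: eventually_at_filter)
  qed
  then show ?thesis unfolding has_L2_time_derivative_def L2_iff_sq_integrable by blast
qed

lemma sq_integrable_quotient:
  assumes "sq_integrable a b f" "sq_integrable a b g"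
  shows "sq_integrable a b (\<lambda>x. (f x - g x) / c)"
  using sq_integrable_cmult[OF sq_integrable_diff[OF assms], of "inverse c"]
  by (simp add: divide_inverse mult.commute)

text \<open>
  The derivative of a difference, up to changing it on a null set.
\<close>

lemma has_L2_time_derivative_perturb:
  assumes u: "has_L2_time_derivative u d t" and v: "has_L2_time_derivative v d' t" and t: "t \<ge> 0"
    and e: "sq_integrable 0 1 e" "energy 0 1 (\<lambda>x. d x - d' x - e x) = 0"
  shows "has_L2_time_derivative (\<lambda>s x. u s x - v s x) e t"
  unfolding has_L2_time_derivative_iff[OF t]
proof (intro conjI allI impI e(1))
  note U = u[unfolded has_L2_time_derivative_iff[OF t]] and V = v[unfolded has_L2_time_derivative_iff[OF t]]
  show "sq_integrable 0 1 (\<lambda>x. u s x - v s x)" if "s \<ge> 0" for s using U V that by (intro sq_integrable_diff) auto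
  let ?q = "\<lambda>u s x. (u s x - u t x) / (s - t) :: real"
  show "((\<lambda>s. energy 0 1 (\<lambda>x. ?q (\<lambda>s x. u s x - v s x) s x - e x)) \<longlongrightarrow> 0) (at t within {0..})"
  proof (rule Lim_null_comparison)
    show "((\<lambda>s. 4 * energy 0 1 (\<lambda>x. ?q u s x - d x) + 4 * energy 0 1 (\<lambda>x. ?q v s x - d' x)) \<longlongrightarrow> 0) (at t within {0..})"
      using U V by (auto intro!: tendsto_eq_intros)
    have "\<forall>\<^sub>F s in at t within {0..}. s \<ge> 0" by (simp add: eventually_at_filter)
    then show "\<forall>\<^sub>F s in at t within {0..}. norm (energy 0 1 (\<lambda>x. ?q (\<lambda>s x. u s x - v s x) s x - e x))
        \<le> 4 * energy 0 1 (\<lambda>x. ?q u s x - d x) + 4 * energy 0 1 (\<lambda>x. ?q v s x - d' x)"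
    proof eventually_elim
      case (elim s)
      have su: "sq_integrable 0 1 (\<lambda>x. ?q u s x - d x)" and sv: "sq_integrable 0 1 (\<lambda>x. ?q v s x - d' x)"
        using U V elim t by (intro sq_integrable_diff sq_integrable_quotient; simp)+
      have sv': "sq_integrable 0 1 (\<lambda>x. - 1 * (?q v s x - d' x))" by (rule sq_integrable_cmult[OF sv])
      have sd: "sq_integrable 0 1 (\<lambda>x. d x - d' x - e x)" using U V e by (intro sq_integrable_diff) auto
      have "energy 0 1 (\<lambda>x. ?q (\<lambda>s x. u s x - v s x) s x - e x)
         = energy 0 1 (\<lambda>x. ((?q u s x - d x) + - 1 * (?q v s x - d' x)) + (d x - d' x - e x))"
        by (rule arg_cong[where f = "energy 0 1"], rule ext) (simp add: diff_divide_distrib)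
      also have "\<dots> \<le> 2 * energy 0 1 (\<lambda>x. (?q u s x - d x) + - 1 * (?q v s x - d' x)) + 2 * energy 0 1 (\<lambda>x. d x - d' x - e x)"
        by (intro energy_add_le sq_integrable_add su sv' sd)
      also have "energy 0 1 (\<lambda>x. (?q u s x - d x) + - 1 * (?q v s x - d' x))
          \<le> 2 * energy 0 1 (\<lambda>x. ?q u s x - d x) + 2 * energy 0 1 (\<lambda>x. - 1 * (?q v s x - d' x))"
        by (intro energy_add_le su sv')
      finally show ?case using energy_cmult[of 0 1 "-1" "\<lambda>x. ?q v s x - d' x"] e(2) by simp
    qed
  qed
qed

text \<open>
  With \<open>q\<close> the difference quotient of \<open>u\<close>, the quotient of the energies is exactly
  \<open>2 * \<integral> u[t] * q + (s - t) * \<integral> q\<^sup>2\<close>. The first integral converges by the Cauchy-Schwarz inequality, and the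
  second stays bounded.
\<close>

lemma energy_has_derivative:
  assumes u: "has_L2_time_derivative u d t" and t: "t \<ge> 0"
  shows "((\<lambda>s. energy 0 1 (u s)) has_real_derivative 2 * integral {0..1} (\<lambda>x. u t x * d x)) (at t within {0..})"
proof -
  note U = u[unfolded has_L2_time_derivative_iff[OF t]]
  have su: "sq_integrable 0 1 (u s)" if "s \<ge> 0" for s using U that by blast
  have sd: "sq_integrable 0 1 d" using U by blast
  define q where "q s x = (u s x - u t x) / (s - t)" for s x
  have sq: "sq_integrable 0 1 (q s)" if "s \<ge> 0" for s
    unfolding q_def by (intro sq_integrable_quotient su that t)
  have lim: "((\<lambda>s. energy 0 1 (\<lambda>x. q s x - d x)) \<longlongrightarrow> 0) (at t within {0..})" using U by (simp add: q_def)
  let ?b = "\<lambda>s. 2 * sqrt (energy 0 1 (u t) * energy 0 1 (\<lambda>x. q s x - d x))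
     + \<bar>s - t\<bar> * (2 * energy 0 1 (\<lambda>x. q s x - d x) + 2 * energy 0 1 d)"
  have "((\<lambda>s. (energy 0 1 (u s) - energy 0 1 (u t)) / (s - t) - 2 * integral {0..1} (\<lambda>x. u t x * d x)) \<longlongrightarrow> 0) (at t within {0..})"
  proof (rule Lim_null_comparison)
    have "(?b \<longlongrightarrow> 2 * sqrt (energy 0 1 (u t) * 0) + \<bar>t - t\<bar> * (2 * 0 + 2 * energy 0 1 d)) (at t within {0..})"
      by (intro tendsto_intros lim)
    then show "(?b \<longlongrightarrow> 0) (at t within {0..})" by simp
    have "\<forall>\<^sub>F s in at t within {0..}. s \<ge> 0 \<and> s \<noteq> t" by (simp add: eventually_at_filter)
    then show "\<forall>\<^sub>F s in at t within {0..}. norm ((energy 0 1 (u s) - energy 0 1 (u t)) / (s - t)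
        - 2 * integral {0..1} (\<lambda>x. u t x * d x)) \<le> ?b s"
    proof eventually_elim
      case (elim s)
      then have s0: "s \<ge> 0" and st: "s - t \<noteq> 0" by auto
      note int = sq_integrable_mult_integrable
      have us: "u s x = u t x + (s - t) * q s x" for x using st by (simp add: q_def)
      have "energy 0 1 (u s) = integral {0..1} (\<lambda>x. u t x * u t x + ((2 * (s - t)) * (u t x * q s x) + (s - t)\<^sup>2 * (q s x * q s x)))"
        unfolding energy_def us by (simp add: power2_eq_square algebra_simps)
      also have "\<dots> = energy 0 1 (u t) + (2 * (s - t) * integral {0..1} (\<lambda>x. u t x * q s x) + (s - t)\<^sup>2 * energy 0 1 (q s))"
      proof -
        have "((\<lambda>x. u t x * u t x + ((2 * (s - t)) * (u t x * q s x) + (s - t)\<^sup>2 * (q s x * q s x))) has_integral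
           (integral {0..1} (\<lambda>x. u t x * u t x) + (2 * (s - t) * integral {0..1} (\<lambda>x. u t x * q s x)
            + (s - t)\<^sup>2 * integral {0..1} (\<lambda>x. q s x * q s x)))) {0..1}"
          by (intro has_integral_add has_integral_mult_right integrable_integral int su[OF t] sq[OF s0])
        then show ?thesis by (simp add: integral_unique energy_def power2_eq_square)
      qed
      finally have 1: "(energy 0 1 (u s) - energy 0 1 (u t)) / (s - t)
          = 2 * integral {0..1} (\<lambda>x. u t x * q s x) + (s - t) * energy 0 1 (q s)"
        using st by (simp add: field_simps power2_eq_square)
      have 2: "integral {0..1} (\<lambda>x. u t x * q s x) - integral {0..1} (\<lambda>x. u t x * d x)
         = integral {0..1} (\<lambda>x. u t x * (q s x - d x))"
        unfolding right_diff_distrib by (intro integral_diff[symmetric] int su[OF t] sq[OF s0] sd)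
      have "(integral {0..1} (\<lambda>x. u t x * (q s x - d x)))\<^sup>2 \<le> energy 0 1 (u t) * energy 0 1 (\<lambda>x. q s x - d x)"
        by (intro Cauchy_Schwarz_integral sq_integrable_diff su[OF t] sq[OF s0] sd)
      then have 3: "\<bar>integral {0..1} (\<lambda>x. u t x * (q s x - d x))\<bar> \<le> sqrt (energy 0 1 (u t) * energy 0 1 (\<lambda>x. q s x - d x))"
        using real_le_rsqrt by fastforce
      have "energy 0 1 (\<lambda>x. (q s x - d x) + d x) \<le> 2 * energy 0 1 (\<lambda>x. q s x - d x) + 2 * energy 0 1 d"
        by (intro energy_add_le sq_integrable_diff sq[OF s0] sd)
      then have "\<bar>(s - t) * energy 0 1 (q s)\<bar> \<le> \<bar>s - t\<bar> * (2 * energy 0 1 (\<lambda>x. q s x - d x) + 2 * energy 0 1 d)"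
        by (auto simp: abs_mult intro!: mult_left_mono)
      then show ?case unfolding 1 using 2 3 by (simp add: abs_if split: if_splits)
    qed
  qed
  then show ?thesis unfolding has_field_derivative_iff by (simp add: LIM_zero_iff)
qed

text \<open>
  Gronwall: \<open>exp (- c * t) * E t\<close> is nonincreasing, nonnegative and starts at zero.
\<close>

lemma nonneg_zero_if_linear_differential_inequality:
  fixes E :: "real \<Rightarrow> real"
  assumes der: "\<And>t. t \<ge> 0 \<Longrightarrow> (E has_real_derivative E' t) (at t within {0..})"
    and le: "\<And>t. t \<ge> 0 \<Longrightarrow> E' t \<le> c * E t" and "E 0 = 0" "\<And>t. E t \<ge> 0" "t \<ge> 0"
  shows "E t = 0"
proof (cases "t = 0")
  case False
  then have "t > 0" using \<open>t \<ge> 0\<close> by simp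
  define F where "F s = exp (- c * s) * E s" for s
  have dF: "(F has_real_derivative exp (- c * s) * (E' s - c * E s)) (at s within {0..})" if "s \<ge> 0" for s
    unfolding F_def by (auto intro!: derivative_eq_intros der[OF that] simp: algebra_simps)
  have "F t \<le> F 0"
  proof (rule DERIV_nonpos_imp_decreasing_open[OF less_imp_le[OF \<open>t > 0\<close>]])
    show "\<exists>y. (F has_real_derivative y) (at s) \<and> y \<le> 0" if "0 < s" "s < t" for s
    proof -
      have "at s within {0..} = at s" using that by (intro at_within_interior) (simp add: interior_real_atLeast)
      then have "(F has_real_derivative exp (- c * s) * (E' s - c * E s)) (at s)" using dF[of s] that by simp
      moreover have "exp (- c * s) * (E' s - c * E s) \<le> 0" using le[of s] that by (simp add: mult_nonneg_nonpos)
      ultimately show ?thesis by blast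
    qed
    show "continuous_on {0..t} F"
      by (rule continuous_on_subset[OF DERIV_continuous_on[OF dF]]) auto
  qed
  then have "exp (- c * t) * E t \<le> 0" using \<open>E 0 = 0\<close> by (simp add: F_def)
  then show ?thesis using assms(4)[of t] by (simp add: mult_le_0_iff)
qed (simp add: \<open>E 0 = 0\<close>)

lemma energy_zero_imp_zero:
  assumes "continuous_on {0..1} f" "energy 0 1 f = 0" "x \<in> {0..1}"
  shows "f x = 0"
proof -
  have "continuous_on {0..1} (\<lambda>x. (f x)\<^sup>2)" by (intro continuous_intros assms)
  then show ?thesis
    using integral_eq_0_iff[of 0 1 "\<lambda>x. (f x)\<^sup>2"] assms(2,3) by (simp add: energy_def)
qed

lemma energy_eq_0I:
  assumes "\<And>x. x \<in> {a..b} \<Longrightarrow> f x = 0"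
  shows "energy a b f = 0"
  unfolding energy_def by (rule trans[OF integral_cong[of _ _ "\<lambda>_. 0"]]) (simp_all add: assms)

lemma continuous_on_slice:
  fixes F :: "real \<Rightarrow> real \<Rightarrow> real"
  assumes F: "continuous_on (T \<times> A) (\<lambda>z. F (fst z) (snd z))" and "t \<in> T"
  shows "continuous_on A (F t)"
proof -
  have "continuous_on A (\<lambda>x. (t, x))" by (intro continuous_intros)
  then show ?thesis using continuous_on_compose2[OF F, of A "\<lambda>x. (t, x)"] \<open>t \<in> T\<close> by auto
qed

lemma isCont_if_has_L2_deriv:
  assumes "\<And>a b. has_L2_deriv a b w k"
  shows "isCont w y"
proof (rule continuous_on_interior)
  show "continuous_on {y - 1..y + 1} w" by (rule has_L2_deriv_continuous[OF assms])
qed (simp add: interior_atLeastAtMost_real)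

lemma energy_tendsto_0_if_jointly_continuous:
  fixes F :: "real \<Rightarrow> real \<Rightarrow> real"
  assumes F: "continuous_on ({0..} \<times> {0..1}) (\<lambda>z. F (fst z) (snd z))" and t: "t \<ge> 0"
  shows "((\<lambda>s. energy 0 1 (\<lambda>x. F s x - F t x)) \<longlongrightarrow> 0) (at t within {0..})"
proof (rule energy_tendsto_0_if_uniform)
  have cont: "continuous_on {0..1} (F s)" if "s \<ge> 0" for s
    using continuous_on_slice[OF F] that by simp
  show "sq_integrable 0 1 (\<lambda>x. F s x - F t x)" if "s \<in> {0..}" for s
    using that t by (intro sq_integrable_continuous continuous_on_diff cont) auto
  show "\<forall>\<^sub>F s in at t within {0..}. \<forall>x\<in>{0..1}. \<bar>F s x - F t x\<bar> \<le> e" if "e > 0" for e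
    by (rule eventually_uniformly_close[OF F]) (use t that in auto)
qed (use t in simp)

lemma C0_L2_if_jointly_continuous:
  assumes F: "continuous_on ({0..} \<times> {0..1}) (\<lambda>z. F (fst z) (snd z))"
  shows "C0_L2 F"
proof (rule C0_L2_I)
  show "sq_integrable 0 1 (F t)" if "t \<ge> 0" for t
    using continuous_on_slice[OF F] that by (intro sq_integrable_continuous) simp
qed (rule energy_tendsto_0_if_jointly_continuous[OF F])

text \<open>
  A classical time derivative that is jointly continuous is also an \<open>L\<^sup>2\<close> derivative: by the mean value theorem the
  quotient at \<open>x\<close> is the derivative at an intermediate time, uniformly close to the derivative at time \<open>t\<close>.
\<close>

lemma has_L2_time_derivative_if_pointwise:
  assumes d: "continuous_on ({0..} \<times> {0..1}) (\<lambda>z. d (fst z) (snd z))"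
    and v: "\<And>s. s \<ge> 0 \<Longrightarrow> sq_integrable 0 1 (v s)"
    and der: "\<And>s x. s \<ge> 0 \<Longrightarrow> x \<in> {0..1} \<Longrightarrow> ((\<lambda>s. v s x) has_real_derivative d s x) (at s within {0..})"
    and t: "t \<ge> 0"
  shows "has_L2_time_derivative v (d t) t"
  unfolding has_L2_time_derivative_iff[OF t]
proof (intro conjI allI impI v)
  show sd: "sq_integrable 0 1 (d t)"
    using continuous_on_slice[OF d] t by (intro sq_integrable_continuous) simp
  show "((\<lambda>s. energy 0 1 (\<lambda>x. (v s x - v t x) / (s - t) - d t x)) \<longlongrightarrow> 0) (at t within {0..})"
  proof (rule energy_tendsto_0_if_uniform)
    show "sq_integrable 0 1 (\<lambda>x. (v s x - v t x) / (s - t) - d t x)" if "s \<in> {0..}" for s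
      using that t by (intro sq_integrable_diff sq_integrable_quotient v sd) auto
    fix e :: real assume "e > 0"
    then have "\<forall>\<^sub>F r in at t within {0..}. \<forall>x\<in>{0..1}. \<bar>d r x - d t x\<bar> \<le> e"
      by (intro eventually_uniformly_close[OF d]) (use t in auto)
    then obtain \<delta> where "\<delta> > 0" and \<delta>: "\<And>r x. r \<ge> 0 \<Longrightarrow> r \<noteq> t \<Longrightarrow> dist r t < \<delta> \<Longrightarrow> x \<in> {0..1} \<Longrightarrow> \<bar>d r x - d t x\<bar> \<le> e"
      by (auto simp: eventually_at)
    have "\<forall>\<^sub>F s in at t within {0..}. s \<ge> 0 \<and> s \<noteq> t \<and> dist s t < \<delta>"
      using \<open>\<delta> > 0\<close> by (auto simp: eventually_at)
    then show "\<forall>\<^sub>F s in at t within {0..}. \<forall>x\<in>{0..1}. \<bar>(v s x - v t x) / (s - t) - d t x\<bar> \<le> e"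
    proof eventually_elim
      case (elim s)
      show ?case
      proof
        fix x :: real assume x: "x \<in> {0..1}"
        have mv: "\<exists>r. a < r \<and> r < b \<and> v b x - v a x = (b - a) * d r x" if ab: "0 \<le> a" "a < b" for a b
        proof -
          have "\<exists>r\<in>{a<..<b}. v b x - v a x = (\<lambda>y. d r x * y) (b - a)"
          proof (rule mvt_simple[OF ab(2)])
            fix r assume "a \<le> r" "r \<le> b"
            then show "((\<lambda>s. v s x) has_derivative (\<lambda>y. d r x * y)) (at r within {a..b})"
              using DERIV_subset[OF der[of r x], of "{a..b}"] ab x
              by (auto simp: has_field_derivative_def)
          qed
          then show ?thesis by (auto simp: mult.commute)
        qed
        have "\<exists>r\<ge>0. r \<noteq> t \<and> dist r t < \<delta> \<and> (v s x - v t x) / (s - t) = d r x"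
        proof (cases "s < t")
          case True
          then obtain r where "s < r" "r < t" "v t x - v s x = (t - s) * d r x" using mv[of s t] elim by auto
          then show ?thesis using elim True by (intro exI[of _ r]) (auto simp: dist_real_def field_simps)
        next
          case False
          then obtain r where "t < r" "r < s" "v s x - v t x = (s - t) * d r x" using mv[of t s] elim t by auto
          then show ?thesis using elim t by (intro exI[of _ r]) (auto simp: dist_real_def)
        qed
        then show "\<bar>(v s x - v t x) / (s - t) - d t x\<bar> \<le> e" using \<delta> x by auto
      qed
    qed
  qed (use t in simp)
qed

section \<open>The explicit solution\<close>

text \<open>
  Changing the time by \<open>s - t\<close> translates the profile by \<open>h = - lam * (s - t)\<close>. Continuity in time is therefore
  continuity of translation, and the time derivative is \<open>- lam\<close> times the limit of spatial difference quotients.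
\<close>

lemma travelling_wave:
  assumes lam: "lam > 0" and D: "\<And>a b. has_L2_deriv a b w k"
  defines "u \<equiv> \<lambda>t x. w (x - lam * t)" and "k' \<equiv> \<lambda>t x. k (x - lam * t)"
  shows "C0_H1 u" "C1_L2 u" "t \<ge> 0 \<Longrightarrow> has_L2_time_derivative u (\<lambda>x. - lam * weak_deriv (u t) x) t"
proof -
  have Du: "has_L2_deriv a b (u t) (k' t)" for a b t
    using has_L2_deriv_shift[of a "- lam * t" b w k] D by (simp add: u_def k'_def)
  have filt: "filterlim (\<lambda>s. - (lam * (s - t))) (at 0) (at t within {0..})" for t
    unfolding filterlim_at using lam by (auto intro!: tendsto_eq_intros simp: eventually_at_filter)
  have lim_k: "((\<lambda>s. energy 0 1 (\<lambda>x. k' s x - k' t x)) \<longlongrightarrow> 0) (at t within {0..})" for t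
  proof -
    have "((\<lambda>s. energy 0 1 (\<lambda>x. k' t (x + - (lam * (s - t))) - k' t x)) \<longlongrightarrow> 0) (at t within {0..})"
      by (rule filterlim_compose[OF translation_continuous_L2[OF has_L2_derivD(1)[OF Du]] filt])
    then show ?thesis by (simp add: k'_def algebra_simps)
  qed
  have cw: "continuous_on UNIV w" using isCont_if_has_L2_deriv[OF D] by (simp add: continuous_at_imp_continuous_on)
  have cu: "continuous_on ({0..} \<times> {0..1}) (\<lambda>z. u (fst z) (snd z))"
    unfolding u_def by (intro continuous_on_compose2[OF cw] continuous_intros) auto
  show "C0_H1 u"
    by (rule C0_H1_I[OF Du energy_tendsto_0_if_jointly_continuous[OF cu] lim_k])
  have su: "sq_integrable 0 1 (u t)" and sk: "sq_integrable 0 1 (k' t)" for t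
    using Du has_L2_deriv_continuous sq_integrable_continuous has_L2_derivD(1) by blast+
  have der: "has_L2_time_derivative u (\<lambda>x. - lam * k' t x) t" if t: "t \<ge> 0" for t
    unfolding has_L2_time_derivative_iff[OF t]
  proof (intro conjI allI impI su sq_integrable_cmult sk)
    let ?q = "\<lambda>s x. (u t (x + - (lam * (s - t))) - u t x) / (- (lam * (s - t))) - k' t x"
    have "((\<lambda>s. energy 0 1 (?q s)) \<longlongrightarrow> 0) (at t within {0..})"
      by (rule filterlim_compose[OF difference_quotient_tendsto_L2[OF Du] filt])
    then have "((\<lambda>s. (- lam)\<^sup>2 * energy 0 1 (?q s)) \<longlongrightarrow> 0) (at t within {0..})"
      by (rule tendsto_mult_right_zero)
    then have "((\<lambda>s. energy 0 1 (\<lambda>x. - lam * ?q s x)) \<longlongrightarrow> 0) (at t within {0..})"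
      unfolding energy_cmult .
    moreover have "- lam * ?q s x = (u s x - u t x) / (s - t) - - lam * k' t x" for s x
    proof -
      have "u t (x + - (lam * (s - t))) = u s x" by (simp add: u_def algebra_simps)
      then show ?thesis using lam by (cases "s = t") (simp_all add: field_simps)
    qed
    ultimately show "((\<lambda>s. energy 0 1 (\<lambda>x. (u s x - u t x) / (s - t) - - lam * k' t x)) \<longlongrightarrow> 0) (at t within {0..})"
      by simp
  qed
  have "C0_L2 (\<lambda>t x. - lam * k' t x)"
  proof (rule C0_L2_I)
    fix t :: real
    show "sq_integrable 0 1 (\<lambda>x. - lam * k' t x)" by (rule sq_integrable_cmult[OF sk])
    have "((\<lambda>s. energy 0 1 (\<lambda>x. - lam * (k' s x - k' t x))) \<longlongrightarrow> 0) (at t within {0..})"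
      unfolding energy_cmult by (rule tendsto_mult_right_zero[OF lim_k])
    then show "((\<lambda>s. energy 0 1 (\<lambda>x. - lam * k' s x - - lam * k' t x)) \<longlongrightarrow> 0) (at t within {0..})"
      by (simp only: right_diff_distrib)
  qed
  then show "C1_L2 u" unfolding C1_L2_def using der by blast
  show "has_L2_time_derivative u (\<lambda>x. - lam * weak_deriv (u t) x) t" if t: "t \<ge> 0" for t
  proof -
    have sw: "sq_integrable 0 1 (weak_deriv (u t))"
      by (rule has_L2_derivD(1)[OF H1_imp_has_L2_deriv[OF has_L2_deriv_imp_H1[OF Du]]])
    have "has_L2_time_derivative (\<lambda>s x. 0) (\<lambda>x. 0) t"
      unfolding has_L2_time_derivative_iff[OF t] by (auto intro!: sq_integrable_continuous simp: energy_def)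
    moreover have "energy 0 1 (\<lambda>x. - lam * k' t x - 0 - - lam * weak_deriv (u t) x) = 0"
    proof -
      have "energy 0 1 (\<lambda>x. lam * (weak_deriv (u t) x - k' t x)) = 0"
        unfolding energy_cmult energy_weak_deriv_diff[OF Du] by simp
      then show ?thesis by (simp add: algebra_simps)
    qed
    ultimately have "has_L2_time_derivative (\<lambda>s x. u s x - 0) (\<lambda>x. - lam * weak_deriv (u t) x) t"
      by (intro has_L2_time_derivative_perturb[OF der[OF t]] t sq_integrable_cmult sw)
    then show ?thesis by simp
  qed
qed

text \<open>
  The initial profile \<open>u0\<close> on \<open>[0,1]\<close> is preceded by the input, which has to enter at \<open>x = 0\<close> at time \<open>t\<close> and hence
  sits at position \<open>- lam * t\<close>. The compatibility condition makes the two pieces match at \<open>0\<close>. Positions beyond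
  \<open>1\<close> are never seen from \<open>[0,1]\<close>; a constant continuation keeps the profile defined on the whole line.
\<close>

lemma glued_profile_exists:
  assumes lam: "lam > 0" and u0: "u0 \<in> H1" and U: "C1_input U" and compat: "U 0 = u0 0"
  obtains w k where "\<And>a b. has_L2_deriv a b w k" "\<And>x. x \<in> {0..1} \<Longrightarrow> w x = u0 x"
    "\<And>t. t \<ge> 0 \<Longrightarrow> w (- lam * t) = U t"
proof -
  obtain U' where cU': "continuous_on {0..} U'"
    and U': "\<And>t. t \<ge> 0 \<Longrightarrow> (U has_real_derivative U' t) (at t within {0..})"
    using U by (auto simp: C1_input_def)
  define w where "w y = (if y \<le> 0 then U (- y / lam) else if y \<le> 1 then u0 y else u0 1)" for y
  define k where "k y = (if y \<le> 0 then - U' (- y / lam) / lam else if y < 1 then weak_deriv u0 y else 0)" for y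
  have past: "has_L2_deriv a 0 w k" for a
  proof -
    have "has_L2_deriv a 0 (\<lambda>y. U (- y / lam)) (\<lambda>y. U' (- y / lam) * (- 1 / lam))"
    proof (rule has_L2_deriv_C1)
      show "continuous_on {a..0} (\<lambda>y. U' (- y / lam) * (- 1 / lam))"
        using lam by (intro continuous_intros continuous_on_compose2[OF cU']) (auto simp: field_simps)
      fix y assume y: "y \<in> {a..0}"
      have "(U has_real_derivative U' (- y / lam)) (at (- y / lam) within (\<lambda>y. - y / lam) ` {a..0})"
        by (rule DERIV_subset[OF U']) (use y lam in \<open>auto simp: field_simps\<close>)
      moreover have "((\<lambda>y. - y / lam) has_real_derivative - 1 / lam) (at y within {a..0})"
        using lam by (auto intro!: derivative_eq_intros)
      ultimately show "((\<lambda>y. U (- y / lam)) has_real_derivative U' (- y / lam) * (- 1 / lam)) (at y within {a..0})"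
        unfolding o_def[of U "\<lambda>y. - y / lam", symmetric] by (rule DERIV_image_chain)
    qed
    then show ?thesis by (rule has_L2_deriv_spike) (auto simp: w_def k_def)
  qed
  have "has_L2_deriv 0 1 w k"
    by (rule has_L2_deriv_spike[OF H1_imp_has_L2_deriv[OF u0]]) (auto simp: w_def k_def compat)
  then have past1: "has_L2_deriv a 1 w k" if "a \<le> 0" for a
    using has_L2_deriv_combine[OF past] that by simp
  have "has_L2_deriv 1 b (\<lambda>_. u0 1) (\<lambda>_. 0)" for b by (auto simp: has_L2_deriv_def intro: sq_integrable_continuous)
  then have future: "has_L2_deriv 1 b w k" for b
    by (rule has_L2_deriv_spike) (auto simp: w_def k_def)
  have "has_L2_deriv a b w k" for a b
    using has_L2_deriv_combine[OF past1 future, of "min a 0" "max b 1"]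
    by (rule has_L2_deriv_subinterval) auto
  moreover have "w x = u0 x" if "x \<in> {0..1}" for x using that compat by (auto simp: w_def)
  moreover have "w (- lam * t) = U t" if "t \<ge> 0" for t using lam that by (simp add: w_def zero_le_mult_iff)
  ultimately show ?thesis by (rule that)
qed

text \<open>
  The solution of \<open>\<partial>\<^sub>t v = \<psi> * v + \<omega> * u\<close> for \<open>u t x = w (x - lam * t)\<close>: substituting \<open>y = x - lam * s\<close> in the
  variation of constants formula turns \<open>\<integral>\<^sub>0\<^sup>t exp (\<psi> * (t - s)) * u s x ds\<close> into an increment of an antiderivative \<open>G\<close> of
  \<open>exp (\<psi> / lam * y) * w y\<close>. Apart from \<open>v0\<close>, everything is then continuously differentiable in \<open>(t,x)\<close>.
\<close>

definition forced_growth :: "real \<Rightarrow> real \<Rightarrow> real \<Rightarrow> (real \<Rightarrow> real) \<Rightarrow> (real \<Rightarrow> real) \<Rightarrow> real \<Rightarrow> real \<Rightarrow> real" where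
  "forced_growth lam \<psi> \<omega> v0 G t x =
     exp (\<psi> * t) * v0 x + \<omega> / lam * exp (\<psi> * t - \<psi> / lam * x) * (G x - G (x - lam * t))"

lemma explicit_solution:
  assumes lam: "lam > 0" and D: "\<And>a b. has_L2_deriv a b w k"
    and w0: "\<And>x. x \<in> {0..1} \<Longrightarrow> w x = u0 x" and wU: "\<And>t. t \<ge> 0 \<Longrightarrow> w (- lam * t) = U t"
    and v0: "v0 \<in> H1"
    and G: "\<And>y. (G has_real_derivative exp (\<psi> / lam * y) * w y) (at y)"
  shows "is_solution lam \<psi> \<omega> u0 v0 U (\<lambda>t x. w (x - lam * t)) (forced_growth lam \<psi> \<omega> v0 G)"
proof -
  define u where "u t x = w (x - lam * t)" for t x
  define v where "v = forced_growth lam \<psi> \<omega> v0 G"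
  define B where "B t x = \<omega> / lam * exp (\<psi> * t - \<psi> / lam * x) * (G x - G (x - lam * t))" for t x
  define Bx where "Bx t x = - (\<psi> / lam) * B t x + \<omega> / lam * exp (\<psi> * t) * w x - \<omega> / lam * u t x" for t x
  have v_eq: "v t x = exp (\<psi> * t) * v0 x + B t x" for t x by (simp add: v_def forced_growth_def B_def)
  note wave = travelling_wave[OF lam D, folded u_def]
  have cw: "continuous_on UNIV w" using isCont_if_has_L2_deriv[OF D] by (simp add: continuous_at_imp_continuous_on)
  have cG: "continuous_on UNIV G" using G DERIV_isCont by (intro continuous_at_imp_continuous_on) blast
  have Dv0: "has_L2_deriv 0 1 v0 (weak_deriv v0)" by (rule H1_imp_has_L2_deriv[OF v0])
  have cv0: "continuous_on {0..1} v0" by (rule has_L2_deriv_continuous[OF Dv0])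
  have cu: "continuous_on ({0..} \<times> {0..1}) (\<lambda>z. u (fst z) (snd z))"
    unfolding u_def by (intro continuous_on_compose2[OF cw] continuous_intros) auto
  have cB: "continuous_on ({0..} \<times> {0..1}) (\<lambda>z. B (fst z) (snd z))"
    unfolding B_def by (intro continuous_on_compose2[OF cG] continuous_intros) auto
  have cBx: "continuous_on ({0..} \<times> {0..1}) (\<lambda>z. Bx (fst z) (snd z))"
    unfolding Bx_def by (intro continuous_on_compose2[OF cw] continuous_intros cB cu) auto
  have cv: "continuous_on ({0..} \<times> {0..1}) (\<lambda>z. v (fst z) (snd z))"
    unfolding v_eq by (intro continuous_intros continuous_on_compose2[OF cv0] cB) auto
  have dBx: "((\<lambda>x. B t x) has_real_derivative Bx t x) (at x)" for t x
  proof -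
    have G': "((\<lambda>x. G (x - lam * t)) has_real_derivative exp (\<psi> / lam * (x - lam * t)) * w (x - lam * t)) (at x)"
    proof -
      have "((\<lambda>x. x - lam * t) has_real_derivative 1) (at x)" by (auto intro!: derivative_eq_intros)
      from DERIV_chain2[OF G this] show ?thesis by simp
    qed
    have "((\<lambda>x. B t x) has_real_derivative
        \<omega> / lam * (exp (\<psi> * t - \<psi> / lam * x) * (- (\<psi> / lam))) * (G x - G (x - lam * t)) +
        (exp (\<psi> / lam * x) * w x - exp (\<psi> / lam * (x - lam * t)) * w (x - lam * t)) * (\<omega> / lam * exp (\<psi> * t - \<psi> / lam * x))) (at x)"
      unfolding B_def using lam by (intro DERIV_mult DERIV_diff G G') (auto intro!: derivative_eq_intros)
    moreover have "exp (\<psi> / lam * x) * exp (\<psi> * t - \<psi> / lam * x) = exp (\<psi> * t)"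
      by (simp flip: exp_add)
    moreover have "exp (\<psi> / lam * (x - lam * t)) * exp (\<psi> * t - \<psi> / lam * x) = 1"
      using lam by (simp add: field_simps flip: exp_add)
    moreover have "c * (E * - m) * d + (A1 * w1 - A2 * w2) * (c * E) = - m * (c * E * d) + c * Z * w1 - c * w2"
      if "A1 * E = Z" "A2 * E = 1" for c E m d A1 A2 w1 w2 Z :: real
    proof -
      have "(A1 * w1 - A2 * w2) * (c * E) = c * (A1 * E) * w1 - c * (A2 * E) * w2" by (simp add: algebra_simps)
      then show ?thesis by (simp add: that)
    qed
    ultimately show ?thesis unfolding Bx_def B_def u_def by (elim DERIV_cong) blast
  qed
  have dv: "((\<lambda>t. v t x) has_real_derivative \<psi> * v t x + \<omega> * u t x) (at t)" for t x
  proof -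
    have G': "((\<lambda>t. G (x - lam * t)) has_real_derivative exp (\<psi> / lam * (x - lam * t)) * w (x - lam * t) * (- lam)) (at t)"
    proof -
      have "((\<lambda>t. x - lam * t) has_real_derivative - lam) (at t)" by (auto intro!: derivative_eq_intros)
      from DERIV_chain2[OF G this] show ?thesis .
    qed
    have "((\<lambda>t. v t x) has_real_derivative
       exp (\<psi> * t) * \<psi> * v0 x + (\<omega> / lam * (exp (\<psi> * t - \<psi> / lam * x) * \<psi>) * (G x - G (x - lam * t)) +
        (0 - exp (\<psi> / lam * (x - lam * t)) * w (x - lam * t) * (- lam)) * (\<omega> / lam * exp (\<psi> * t - \<psi> / lam * x)))) (at t)"
      unfolding v_eq B_def
      using lam by (intro DERIV_add DERIV_mult DERIV_diff DERIV_const G') (auto intro!: derivative_eq_intros)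
    moreover have "exp (\<psi> / lam * (x - lam * t)) * exp (\<psi> * t - \<psi> / lam * x) = 1"
      using lam by (simp add: field_simps flip: exp_add)
    ultimately show ?thesis
      using lam by (elim DERIV_cong) (simp add: v_eq B_def u_def algebra_simps)
  qed
  have Dv: "has_L2_deriv 0 1 (v t) (\<lambda>x. exp (\<psi> * t) * weak_deriv v0 x + Bx t x)" if "t \<ge> 0" for t
    unfolding v_eq
    by (intro has_L2_deriv_add has_L2_deriv_cmult Dv0 has_L2_deriv_C1 has_field_derivative_at_within[OF dBx]
        continuous_on_slice[OF cBx])
      (use that in auto)
  have "C0_H1 v"
  proof (rule C0_H1_I[OF Dv energy_tendsto_0_if_jointly_continuous[OF cv]])
    fix t :: real assume t: "t \<ge> 0"
    let ?k = "\<lambda>t x. exp (\<psi> * t) * weak_deriv v0 x + Bx t x"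
    show "((\<lambda>s. energy 0 1 (\<lambda>x. ?k s x - ?k t x)) \<longlongrightarrow> 0) (at t within {0..})"
    proof (rule Lim_null_comparison)
      let ?b = "\<lambda>s. 2 * ((exp (\<psi> * s) - exp (\<psi> * t))\<^sup>2 * energy 0 1 (weak_deriv v0)) + 2 * energy 0 1 (\<lambda>x. Bx s x - Bx t x)"
      have "(?b \<longlongrightarrow> 2 * ((exp (\<psi> * t) - exp (\<psi> * t))\<^sup>2 * energy 0 1 (weak_deriv v0)) + 2 * 0) (at t within {0..})"
        by (intro tendsto_intros energy_tendsto_0_if_jointly_continuous[OF cBx t])
      then show "(?b \<longlongrightarrow> 0) (at t within {0..})" by simp
      have cBxs: "continuous_on {0..1} (Bx s)" if "s \<ge> 0" for s
        using continuous_on_slice[OF cBx] that by simp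
      have "\<forall>\<^sub>F s in at t within {0..}. s \<ge> 0" by (simp add: eventually_at_filter)
      then show "\<forall>\<^sub>F s in at t within {0..}. norm (energy 0 1 (\<lambda>x. ?k s x - ?k t x)) \<le> ?b s"
      proof eventually_elim
        case (elim s)
        have "energy 0 1 (\<lambda>x. (exp (\<psi> * s) - exp (\<psi> * t)) * weak_deriv v0 x + (Bx s x - Bx t x))
          \<le> 2 * energy 0 1 (\<lambda>x. (exp (\<psi> * s) - exp (\<psi> * t)) * weak_deriv v0 x) + 2 * energy 0 1 (\<lambda>x. Bx s x - Bx t x)"
          by (intro energy_add_le sq_integrable_cmult has_L2_derivD(1)[OF Dv0] sq_integrable_diff
              sq_integrable_continuous cBxs elim t)
        moreover have "?k s x - ?k t x
            = (exp (\<psi> * s) - exp (\<psi> * t)) * weak_deriv v0 x + (Bx s x - Bx t x)" for x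
          by (simp add: left_diff_distrib)
        ultimately show ?case by (simp only: energy_cmult real_norm_def abs_of_nonneg[OF energy_nonneg])
      qed
    qed
  qed
  have cd: "continuous_on ({0..} \<times> {0..1}) (\<lambda>z. \<psi> * v (fst z) (snd z) + \<omega> * u (fst z) (snd z))"
    by (intro continuous_intros cv cu)
  have der_v: "has_L2_time_derivative v (\<lambda>x. \<psi> * v t x + \<omega> * u t x) t" if "t \<ge> 0" for t
    by (rule has_L2_time_derivative_if_pointwise[OF cd _ has_field_derivative_at_within[OF dv] that])
      (intro sq_integrable_continuous has_L2_deriv_continuous[OF Dv])
  have "C1_L2 v"
    unfolding C1_L2_def using C0_L2_if_jointly_continuous[OF cd] der_v by blast
  have u_abs: "(\<lambda>t x. w (x - lam * t)) = u" by (simp add: u_def[abs_def])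
  have "u t 0 = U t" if "t \<ge> 0" for t using wU[OF that] by (simp add: u_def)
  moreover have "u 0 x = u0 x \<and> v 0 x = v0 x" if "x \<in> {0..1}" for x
    using w0[OF that] by (simp add: u_def v_eq B_def)
  ultimately show ?thesis
    unfolding is_solution_def u_abs v_def[symmetric]
    using wave \<open>C0_H1 v\<close> \<open>C1_L2 v\<close> der_v by blast
qed

section \<open>Uniqueness\<close>

text \<open>
  Energy estimate. The difference \<open>e\<close> of the transported components satisfies
  \<open>d/dt \<integral> e\<^sup>2 = - lam * (e(t,1)\<^sup>2 - e(t,0)\<^sup>2) \<le> 0\<close>, because both solutions have the same boundary value at \<open>x = 0\<close>.
  Once \<open>e\<close> vanishes, the difference \<open>z\<close> of the other components satisfies \<open>d/dt \<integral> z\<^sup>2 = 2 * \<psi> * \<integral> z\<^sup>2\<close>.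
\<close>

lemma solution_unique:
  assumes lam: "lam > 0"
    and sol: "is_solution lam \<psi> \<omega> u0 v0 U u v" and sol': "is_solution lam \<psi> \<omega> u0 v0 U u' v'"
    and t: "t \<ge> 0" and x: "x \<in> {0..1}"
  shows "u' t x = u t x \<and> v' t x = v t x"
proof -
  note S = sol[unfolded is_solution_def] sol'[unfolded is_solution_def]
  define e where "e t x = u' t x - u t x" for t x
  define z where "z t x = v' t x - v t x" for t x
  define g where "g t x = weak_deriv (u' t) x - weak_deriv (u t) x" for t x
  have De: "has_L2_deriv 0 1 (e t) (g t)" if "t \<ge> 0" for t
    unfolding e_def g_def
    by (intro has_L2_deriv_diff H1_imp_has_L2_deriv) (use S that in \<open>auto simp: C0_H1_def\<close>)
  have Dz: "has_L2_deriv 0 1 (z t) (\<lambda>x. weak_deriv (v' t) x - weak_deriv (v t) x)" if "t \<ge> 0" for t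
    unfolding z_def
    by (intro has_L2_deriv_diff H1_imp_has_L2_deriv) (use S that in \<open>auto simp: C0_H1_def\<close>)
  note ce = has_L2_deriv_continuous[OF De] and cz = has_L2_deriv_continuous[OF Dz]
  have diff_deriv: "has_L2_time_derivative (\<lambda>s x. a s x - b s x) (\<lambda>x. d x - d' x) t"
    if "has_L2_time_derivative a d t" "has_L2_time_derivative b d' t" "t \<ge> 0" for a b d d' t
    by (rule has_L2_time_derivative_perturb[OF that])
      (use that in \<open>auto simp: has_L2_time_derivative_iff energy_def intro: sq_integrable_diff\<close>)
  have e0: "e t x = 0" if t: "t \<ge> 0" and x: "x \<in> {0..1}" for t x
  proof -
    have "energy 0 1 (e t) = 0"
    proof (rule nonneg_zero_if_linear_differential_inequality[of "\<lambda>t. energy 0 1 (e t)" _ 0])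
      fix t :: real assume t: "t \<ge> 0"
      show "((\<lambda>t. energy 0 1 (e t)) has_real_derivative
          2 * integral {0..1} (\<lambda>x. e t x * (- lam * weak_deriv (u' t) x - - lam * weak_deriv (u t) x))) (at t within {0..})"
        unfolding e_def by (intro energy_has_derivative diff_deriv t) (use S t in auto)
      have "2 * integral {0..1} (\<lambda>x. e t x * (- lam * weak_deriv (u' t) x - - lam * weak_deriv (u t) x))
         = 2 * integral {0..1} (\<lambda>x. (- lam / 2) * (g t x * e t x + e t x * g t x))"
        by (simp add: g_def algebra_simps)
      also have "\<dots> = - lam * integral {0..1} (\<lambda>x. g t x * e t x + e t x * g t x)"
        by (simp only: integral_mult_right)
      also have "\<dots> = - lam * (e t 1 * e t 1 - e t 0 * e t 0)"
        by (subst integral_by_parts_L2_deriv[OF De De]) (use t in auto)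
      also have "e t 0 = 0" using S t by (simp add: e_def)
      finally show "2 * integral {0..1} (\<lambda>x. e t x * (- lam * weak_deriv (u' t) x - - lam * weak_deriv (u t) x))
          \<le> 0 * energy 0 1 (e t)"
        using lam by simp
    qed (use S t in \<open>auto simp: e_def intro!: energy_eq_0I\<close>)
    then show ?thesis using energy_zero_imp_zero ce t x by blast
  qed
  have "energy 0 1 (z t) = 0"
  proof (rule nonneg_zero_if_linear_differential_inequality[of "\<lambda>t. energy 0 1 (z t)" _ "2 * \<psi>"])
    fix t :: real assume t: "t \<ge> 0"
    show "((\<lambda>t. energy 0 1 (z t)) has_real_derivative
        2 * integral {0..1} (\<lambda>x. z t x * ((\<psi> * v' t x + \<omega> * u' t x) - (\<psi> * v t x + \<omega> * u t x)))) (at t within {0..})"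
      unfolding z_def by (intro energy_has_derivative diff_deriv t) (use S t in auto)
    have "integral {0..1} (\<lambda>x. z t x * ((\<psi> * v' t x + \<omega> * u' t x) - (\<psi> * v t x + \<omega> * u t x)))
       = integral {0..1} (\<lambda>x. \<psi> * (z t x)\<^sup>2)"
      by (rule integral_cong) (use e0[OF t] in \<open>simp add: z_def e_def power2_eq_square algebra_simps\<close>)
    then show "2 * integral {0..1} (\<lambda>x. z t x * ((\<psi> * v' t x + \<omega> * u' t x) - (\<psi> * v t x + \<omega> * u t x)))
       \<le> 2 * \<psi> * energy 0 1 (z t)"
      by (simp add: energy_def)
  qed (use S t in \<open>auto simp: z_def intro!: energy_eq_0I\<close>)
  then have "z t x = 0" using energy_zero_imp_zero cz t x by blast
  then show ?thesis using e0[OF t x] by (simp add: e_def z_def)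
qed

section \<open>Solutions that do not vanish asymptotically\<close>

text \<open>
  The mean is the best constant approximation: \<open>\<integral> (h - m)\<^sup>2 = \<integral> (h - a)\<^sup>2 + (a - m)\<^sup>2\<close> when \<open>a\<close> is the mean of \<open>h\<close>.
\<close>

lemma energy_about_mean_le:
  assumes h: "sq_integrable 0 1 h"
  shows "energy 0 1 (\<lambda>x. h x - integral {0..1} h) \<le> energy 0 1 (\<lambda>x. h x - m)"
proof -
  define a where "a = integral {0..1} h"
  have sa: "sq_integrable 0 1 (\<lambda>x. h x - a)" by (intro sq_integrable_diff h sq_integrable_continuous continuous_intros)
  have const: "((\<lambda>x :: real. c) has_integral c) {0..1}" for c :: real
    using has_integral_const_real[of c 0 1] by simp
  have "((\<lambda>x. (h x - a)\<^sup>2 + (2 * (a - m) * (h x - a) + (a - m)\<^sup>2)) has_integral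
      energy 0 1 (\<lambda>x. h x - a) + (2 * (a - m) * (a - a) + (a - m)\<^sup>2)) {0..1}"
    unfolding energy_def
    by (intro has_integral_add has_integral_mult_right has_integral_diff const
        integrable_integral[OF sq_integrableD(2)[OF sa]]
        integrable_integral[OF sq_integrableD(1)[OF h], folded a_def])
  moreover have "(\<lambda>x. (h x - a)\<^sup>2 + (2 * (a - m) * (h x - a) + (a - m)\<^sup>2)) = (\<lambda>x. (h x - m)\<^sup>2)"
    by (rule ext) (simp add: power2_eq_square algebra_simps)
  ultimately have "energy 0 1 (\<lambda>x. h x - m) = energy 0 1 (\<lambda>x. h x - a) + (a - m)\<^sup>2"
    by (simp add: energy_def integral_unique)
  then show ?thesis by (simp add: a_def)
qed

text \<open>
  Splitting the increment of \<open>G\<close> in the formula for \<open>v\<close> at \<open>- lam * t\<close> gives, for some \<open>m t\<close> independent of \<open>x\<close>,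
  \<open>h x - m t = exp (\<psi> / lam * x - \<psi> * t) * v t x + \<omega> / lam * exp (- \<psi> * t) * \<integral>\<^sub>0\<^sup>x exp (\<psi> / lam * s) * u t s ds\<close>.
  As \<open>\<psi> \<ge> 0\<close>, all exponential factors are bounded for \<open>t \<ge> 0\<close>, so that \<open>h\<close>, which does not depend on \<open>t\<close>, is an \<open>L\<^sup>2\<close>
  limit of constants whenever \<open>u\<close> and \<open>v\<close> vanish asymptotically. Being continuous, it is constant.
\<close>

lemma conserved_profile_constant_if_vanishing:
  assumes lam: "lam > 0" and \<psi>: "\<psi> \<ge> 0" and cw: "continuous_on UNIV w" and cv0: "continuous_on {0..1} v0"
    and G: "\<And>y. (G has_real_derivative exp (\<psi> / lam * y) * w y) (at y)"
    and u_lim: "((\<lambda>t. norm2 (\<lambda>x. w (x - lam * t))) \<longlongrightarrow> 0) at_top"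
    and v_lim: "((\<lambda>t. norm2 (forced_growth lam \<psi> \<omega> v0 G t)) \<longlongrightarrow> 0) at_top"
  defines "h \<equiv> \<lambda>x. exp (\<psi> / lam * x) * v0 x + \<omega> / lam * G x"
  assumes x: "x \<in> {0..1}"
  shows "h x = h 0"
proof -
  define u where "u t x = w (x - lam * t)" for t x
  define v where "v = forced_growth lam \<psi> \<omega> v0 G"
  define m where "m t = \<omega> / lam * G (- lam * t)" for t
  define M where "M = exp (\<psi> / lam)"
  have cG: "continuous_on A G" for A
    by (rule continuous_on_subset[of UNIV]) (use G DERIV_isCont in \<open>blast intro: continuous_at_imp_continuous_on\<close>, simp)
  have ch: "continuous_on {0..1} h" unfolding h_def by (intro continuous_intros cv0 cG)
  have cu: "continuous_on A (u t)" for t A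
    unfolding u_def by (intro continuous_on_compose2[OF cw] continuous_intros) auto
  have cv: "continuous_on {0..1} (v t)" for t
    unfolding v_def forced_growth_def by (intro continuous_intros cv0 continuous_on_compose2[OF cG[of UNIV]] cG) auto
  have su: "sq_integrable 0 1 (u t)" and sv: "sq_integrable 0 1 (v t)" for t
    by (intro sq_integrable_continuous cu cv)+
  have u_lim': "((\<lambda>t. energy 0 1 (u t)) \<longlongrightarrow> 0) at_top" and v_lim': "((\<lambda>t. energy 0 1 (v t)) \<longlongrightarrow> 0) at_top"
    using u_lim v_lim su sv norm2_tendsto_0_iff[of u at_top] norm2_tendsto_0_iff[of v at_top]
    by (simp_all add: u_def[abs_def] v_def)
  have decomposition: "h x - m t = exp (\<psi> / lam * x - \<psi> * t) * v t x
      + \<omega> / lam * exp (- (\<psi> * t)) * integral {0..x} (\<lambda>s. exp (\<psi> / lam * s) * u t s)"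
    if x: "x \<in> {0..1}" for t x
  proof -
    have "((\<lambda>s. exp (\<psi> / lam * (s - lam * t)) * w (s - lam * t)) has_integral G (x - lam * t) - G (0 - lam * t)) {0..x}"
    proof (rule fundamental_theorem_of_calculus)
      show "((\<lambda>s. G (s - lam * t)) has_vector_derivative exp (\<psi> / lam * (s - lam * t)) * w (s - lam * t)) (at s within {0..x})" for s
      proof -
        have "((\<lambda>s. s - lam * t) has_real_derivative 1) (at s)" by (auto intro!: derivative_eq_intros)
        from DERIV_chain2[OF G this]
        have "((\<lambda>s. G (s - lam * t)) has_real_derivative exp (\<psi> / lam * (s - lam * t)) * w (s - lam * t)) (at s)"
          by simp
        then show ?thesis
          unfolding has_real_derivative_iff_has_vector_derivative[symmetric] by (rule has_field_derivative_at_within)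
      qed
    qed (use x in auto)
    moreover have "exp (\<psi> / lam * (s - lam * t)) * w (s - lam * t) = exp (- (\<psi> * t)) * (exp (\<psi> / lam * s) * u t s)" for s
      using lam by (simp add: u_def right_diff_distrib mult.assoc[symmetric] flip: exp_add)
    ultimately have "integral {0..x} (\<lambda>s. exp (- (\<psi> * t)) * (exp (\<psi> / lam * s) * u t s))
        = G (x - lam * t) - G (0 - lam * t)"
      by (simp only: integral_unique)
    then have "G (x - lam * t) - G (- lam * t) = exp (- (\<psi> * t)) * integral {0..x} (\<lambda>s. exp (\<psi> / lam * s) * u t s)"
      unfolding integral_mult_right by simp
    moreover have "exp (\<psi> / lam * x - \<psi> * t) * v t x = h x - \<omega> / lam * G (x - lam * t)"
    proof -
      have "exp (\<psi> / lam * x - \<psi> * t) * exp (\<psi> * t) = exp (\<psi> / lam * x)"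
        "exp (\<psi> / lam * x - \<psi> * t) * exp (\<psi> * t - \<psi> / lam * x) = 1" by (simp_all flip: exp_add)
      moreover have "exp (\<psi> / lam * x - \<psi> * t) * v t x
          = (exp (\<psi> / lam * x - \<psi> * t) * exp (\<psi> * t)) * v0 x
            + (\<omega> / lam * (G x - G (x - lam * t))) * (exp (\<psi> / lam * x - \<psi> * t) * exp (\<psi> * t - \<psi> / lam * x))"
        unfolding v_def forced_growth_def by (simp only: distrib_left mult_ac)
      ultimately have "exp (\<psi> / lam * x - \<psi> * t) * v t x
          = exp (\<psi> / lam * x) * v0 x + \<omega> / lam * (G x - G (x - lam * t))" by (simp only: mult_1_right)
      then show ?thesis by (simp add: h_def right_diff_distrib)
    qed
    ultimately show ?thesis by (simp add: m_def algebra_simps flip: right_diff_distrib)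
  qed
  have bound: "energy 0 1 (\<lambda>x. h x - m t) \<le> 2 * (M\<^sup>2 * energy 0 1 (v t)) + 2 * ((\<omega> / lam * M)\<^sup>2 * energy 0 1 (u t))"
    if t: "t \<ge> 0" for t
  proof -
    let ?I = "\<lambda>x. integral {0..x} (\<lambda>s. exp (\<psi> / lam * s) * u t s)"
    have ceu: "continuous_on A (\<lambda>s. exp (\<psi> / lam * s) * u t s)" for A by (intro continuous_intros cu)
    have cI: "continuous_on {0..1} ?I"
      by (intro indefinite_integral_continuous_1 integrable_continuous_interval ceu)
    have exp_le: "exp (\<psi> / lam * x) \<le> M" if "x \<in> {0..1}" for x
      using that \<psi> lam mult_left_le[of x "\<psi> / lam"] by (simp add: M_def)
    have E1: "exp (- (\<psi> * t)) \<le> 1" using \<psi> t by simp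
    have I_bound: "(?I x)\<^sup>2 \<le> M\<^sup>2 * energy 0 1 (u t)" if x: "x \<in> {0..1}" for x
    proof -
      have sx: "sq_integrable 0 1 (\<lambda>s. exp (\<psi> / lam * s) * u t s)" by (rule sq_integrable_continuous[OF ceu])
      have "(?I x)\<^sup>2 \<le> (x - 0) * energy 0 x (\<lambda>s. exp (\<psi> / lam * s) * u t s)"
        using x by (intro integral_sq_le_energy sq_integrable_continuous ceu) auto
      also have "\<dots> \<le> 1 * energy 0 1 (\<lambda>s. exp (\<psi> / lam * s) * u t s)"
        using x by (intro mult_mono energy_subinterval[OF sx]) auto
      also have "\<dots> \<le> energy 0 1 (\<lambda>s. M * u t s)"
        unfolding mult_1
      proof (intro energy_mono sx sq_integrable_cmult su)
        show "\<bar>exp (\<psi> / lam * s) * u t s\<bar> \<le> \<bar>M * u t s\<bar>" if "s \<in> {0..1}" for s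
        proof -
          have "exp (\<psi> / lam * s) \<le> \<bar>M\<bar>" using exp_le[OF that] by linarith
          then show ?thesis by (simp add: abs_mult mult_right_mono)
        qed
      qed
      finally show ?thesis by (simp add: energy_cmult)
    qed
    have "energy 0 1 (\<lambda>x. h x - m t) = energy 0 1 (\<lambda>x. exp (\<psi> / lam * x - \<psi> * t) * v t x + \<omega> / lam * exp (- (\<psi> * t)) * ?I x)"
      unfolding energy_def by (rule integral_cong) (simp add: decomposition)
    also have "\<dots> \<le> 2 * energy 0 1 (\<lambda>x. exp (\<psi> / lam * x - \<psi> * t) * v t x) + 2 * energy 0 1 (\<lambda>x. \<omega> / lam * exp (- (\<psi> * t)) * ?I x)"
      by (intro energy_add_le sq_integrable_continuous continuous_intros cv cI)
    also have "energy 0 1 (\<lambda>x. exp (\<psi> / lam * x - \<psi> * t) * v t x) \<le> energy 0 1 (\<lambda>x. M * v t x)"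
    proof (rule energy_mono)
      show "\<bar>exp (\<psi> / lam * x - \<psi> * t) * v t x\<bar> \<le> \<bar>M * v t x\<bar>" if "x \<in> {0..1}" for x
      proof -
        have "exp (\<psi> / lam * x - \<psi> * t) \<le> exp (\<psi> / lam * x)" using \<psi> t by simp
        then have "exp (\<psi> / lam * x - \<psi> * t) \<le> \<bar>M\<bar>" using exp_le[OF that] by linarith
        then show ?thesis by (simp add: abs_mult mult_right_mono)
      qed
    qed (intro sq_integrable_continuous continuous_intros cv)+
    also have "energy 0 1 (\<lambda>x. \<omega> / lam * exp (- (\<psi> * t)) * ?I x) \<le> (sqrt ((\<omega> / lam * M)\<^sup>2 * energy 0 1 (u t)))\<^sup>2 * (1 - 0)"
    proof (rule energy_le_const)
      show "sq_integrable 0 1 (\<lambda>x. \<omega> / lam * exp (- (\<psi> * t)) * ?I x)"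
        by (intro sq_integrable_continuous continuous_intros cI)
      show "\<bar>\<omega> / lam * exp (- (\<psi> * t)) * ?I x\<bar> \<le> sqrt ((\<omega> / lam * M)\<^sup>2 * energy 0 1 (u t))" if x: "x \<in> {0..1}" for x
      proof (rule real_le_rsqrt)
        have "(exp (- (\<psi> * t)))\<^sup>2 \<le> 1" using E1 by (simp add: power_le_one)
        then have "(\<omega> / lam)\<^sup>2 * ((exp (- (\<psi> * t)))\<^sup>2 * (?I x)\<^sup>2) \<le> (\<omega> / lam)\<^sup>2 * (1 * (M\<^sup>2 * energy 0 1 (u t)))"
          by (intro mult_left_mono mult_mono I_bound x) auto
        then show "\<bar>\<omega> / lam * exp (- (\<psi> * t)) * ?I x\<bar>\<^sup>2 \<le> (\<omega> / lam * M)\<^sup>2 * energy 0 1 (u t)"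
          by (simp only: power2_abs power_mult_distrib mult.assoc mult_1)
      qed
    qed simp
    finally show ?thesis by (simp add: energy_cmult)
  qed
  define a where "a = integral {0..1} h"
  have sh: "sq_integrable 0 1 h" by (rule sq_integrable_continuous[OF ch])
  have "((\<lambda>t. 2 * (M\<^sup>2 * energy 0 1 (v t)) + 2 * ((\<omega> / lam * M)\<^sup>2 * energy 0 1 (u t))) \<longlongrightarrow> 2 * (M\<^sup>2 * 0) + 2 * ((\<omega> / lam * M)\<^sup>2 * 0)) at_top"
    by (intro tendsto_intros u_lim' v_lim')
  then have "energy 0 1 (\<lambda>x. h x - a) \<le> 2 * (M\<^sup>2 * 0) + 2 * ((\<omega> / lam * M)\<^sup>2 * 0)"
  proof (rule tendsto_lowerbound)
    show "\<forall>\<^sub>F t in at_top. energy 0 1 (\<lambda>x. h x - a) \<le> 2 * (M\<^sup>2 * energy 0 1 (v t)) + 2 * ((\<omega> / lam * M)\<^sup>2 * energy 0 1 (u t))"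
      using eventually_ge_at_top[of 0]
      by eventually_elim (use energy_about_mean_le[OF sh] bound a_def order_trans in blast)
  qed simp
  then have "energy 0 1 (\<lambda>x. h x - a) = 0" using energy_nonneg[of 0 1 "\<lambda>x. h x - a"] by simp
  then have "h y - a = 0" if "y \<in> {0..1}" for y
    by (rule energy_zero_imp_zero[rotated]) (intro continuous_intros ch that)+
  from this[OF x] this[of 0] show ?thesis by simp
qed

theorem proposition2p1:
  fixes lam \<psi> \<omega> :: real and u0 v0 :: "real \<Rightarrow> real" and U :: "real \<Rightarrow> real"
  assumes "lam > 0" and "\<psi> \<ge> 0"
    and "(u0, v0) \<in> (H1 \<times> H1) - S_space lam \<psi> \<omega>"
    and "C1_input U" and "U 0 = u0 0"
  shows "\<exists>u v. is_solution lam \<psi> \<omega> u0 v0 U u v \<and>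
           (\<forall>u' v'. is_solution lam \<psi> \<omega> u0 v0 U u' v' \<longrightarrow>
              (\<forall>t\<ge>0. \<forall>x\<in>{0..1}. u' t x = u t x \<and> v' t x = v t x)) \<and>
           \<not> (((\<lambda>t. norm2 (u t)) \<longlongrightarrow> 0) at_top \<and> ((\<lambda>t. norm2 (v t)) \<longlongrightarrow> 0) at_top)"
proof -
  have u0: "u0 \<in> H1" and v0: "v0 \<in> H1" using assms(3) by auto
  obtain x where x: "x \<in> {0..1}" and P: "P_op lam \<psi> \<omega> (u0, v0) x \<noteq> 0"
    using assms(3) u0 v0 by (auto simp: S_space_def)
  obtain w k where D: "\<And>a b. has_L2_deriv a b w k" and w0: "\<And>x. x \<in> {0..1} \<Longrightarrow> w x = u0 x"
    and wU: "\<And>t. t \<ge> 0 \<Longrightarrow> w (- lam * t) = U t"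
    using glued_profile_exists[OF assms(1) u0 assms(4,5)] by blast
  note iw = isCont_if_has_L2_deriv[OF D]
  obtain G where G: "\<And>y. (G has_real_derivative exp (\<psi> / lam * y) * w y) (at y)"
  proof (rule ex_antiderivative)
    show "isCont (\<lambda>y. exp (\<psi> / lam * y) * w y) y" for y by (intro continuous_intros iw)
  qed (rule that)
  define u where "u t x = w (x - lam * t)" for t x
  define v where "v = forced_growth lam \<psi> \<omega> v0 G"
  have sol: "is_solution lam \<psi> \<omega> u0 v0 U u v"
    using explicit_solution[OF assms(1) D w0 wU v0 G] by (simp add: u_def[abs_def] v_def)
  have "\<not> (((\<lambda>t. norm2 (u t)) \<longlongrightarrow> 0) at_top \<and> ((\<lambda>t. norm2 (v t)) \<longlongrightarrow> 0) at_top)"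
  proof
    assume lim: "((\<lambda>t. norm2 (u t)) \<longlongrightarrow> 0) at_top \<and> ((\<lambda>t. norm2 (v t)) \<longlongrightarrow> 0) at_top"
    \<comment> \<open>This says that \<open>exp (\<psi> / lam * x) * P (u0, v0) x\<close> vanishes, because that function is the increment of the conserved profile between \<open>0\<close> and \<open>x\<close>.\<close>
    have "exp (\<psi> / lam * x) * v0 x + \<omega> / lam * G x = exp (\<psi> / lam * 0) * v0 0 + \<omega> / lam * G 0"
      using lim iw v0 by (intro conserved_profile_constant_if_vanishing[OF assms(1,2) _ _ G _ _ x, of v0 \<omega>])
        (auto simp: u_def[abs_def] v_def H1_def continuous_at_imp_continuous_on)
    moreover have "integral {0..x} (\<lambda>s. exp (\<psi> / lam * s) * u0 s) = G x - G 0"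
    proof (rule integral_unique)
      have "((\<lambda>s. exp (\<psi> / lam * s) * w s) has_integral G x - G 0) {0..x}"
      proof (rule fundamental_theorem_of_calculus)
        show "(G has_vector_derivative exp (\<psi> / lam * s) * w s) (at s within {0..x})" for s
          unfolding has_real_derivative_iff_has_vector_derivative[symmetric]
          by (rule has_field_derivative_at_within[OF G])
      qed (use x in simp)
      then show "((\<lambda>s. exp (\<psi> / lam * s) * u0 s) has_integral G x - G 0) {0..x}"
        by (rule has_integral_eq[rotated]) (use x in \<open>auto simp: w0\<close>)
    qed
    moreover have "exp (\<psi> / lam * x) * P_op lam \<psi> \<omega> (u0, v0) x
        = exp (\<psi> / lam * x) * v0 x - v0 0 + \<omega> / lam * integral {0..x} (\<lambda>s. exp (\<psi> / lam * s) * u0 s)"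
    proof -
      let ?E = "exp (- (inverse lam * \<psi> * x))"
      let ?I = "integral {0..x} (\<lambda>s. exp (\<psi> / lam * s) * u0 s)"
      have E: "exp (\<psi> / lam * x) * ?E = 1"
        by (simp add: divide_inverse mult.commute flip: exp_add)
      have arg: "- (inverse lam * \<psi> * (x - s)) = - (inverse lam * \<psi> * x) + \<psi> / lam * s" for s
        by (simp add: divide_inverse right_diff_distrib)
      have I: "integral {0..x} (\<lambda>s. exp (- (inverse lam * \<psi> * (x - s))) * u0 s) = ?E * ?I"
      proof -
        have "exp (- (inverse lam * \<psi> * (x - s))) * u0 s = ?E * (exp (\<psi> / lam * s) * u0 s)" for s
          by (subst arg, subst exp_add) (rule mult.assoc)
        then show ?thesis by (simp only: integral_mult_right)
      qed
      have "exp (\<psi> / lam * x) * P_op lam \<psi> \<omega> (u0, v0) x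
          = exp (\<psi> / lam * x) * v0 x - (exp (\<psi> / lam * x) * ?E) * v0 0
            + inverse lam * \<omega> * ((exp (\<psi> / lam * x) * ?E) * ?I)"
        unfolding P_op_def prod.case I by (simp only: distrib_left right_diff_distrib mult_ac)
      then show ?thesis unfolding E by (simp add: divide_inverse)
    qed
    ultimately have "exp (\<psi> / lam * x) * P_op lam \<psi> \<omega> (u0, v0) x = 0"
      by (simp add: right_diff_distrib)
    then show False using P by simp
  qed
  then show ?thesis using sol solution_unique[OF assms(1) sol] by blast
qed

end
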